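(* Let $G$ be a finite connected graph with vertex set $[n]=\{1,\dots,n\}$, with multiple edges allowed and no self-loops. Then $$\mathbb{Q}[\mathrm{Break}(G)]\;\cong\;\mathbb{Q}[x_1,\dots,x_n]/\mathsf{T}(G)\;=\;\mathbb{Q}[x_1,\dots,x_n]/\mathcal{I}(G)\;\cong\;\mathcal{P}(G),$$ where all isomorphisms and equalities are of ungraded $\mathrm{Aut}(G)$-modules, and moreover the middle equality and the right-hand isomorphism hold in the category of graded $\mathrm{Aut}(G)$-modules.
   Context: Let $G$ be a finite connected loopless multigraph on $[n]$ with edge multiset $E(G)$. $\mathrm{Aut}(G)$ is the group of permutations of $[n]$ preserving the number of edges between every pair of vertices; it acts on $\mathbb{Q}^n$ by permuting coordinates and on $\mathbb{Q}[x_1,\dots,x_n]$ by permuting variables. The genus of a connected graph $H$ is $g(H)=|E(H)|-|V(H)|+1$. Break divisors: $\mathrm{Break}(G)$ is the set of $D=(D(1),\dots,D(n))\in\mathbb{Z}_{\ge 0}^n$ with $\sum_v D(v)=g(G)$ such that for every connected subgraph $H$ of $G$ one has $\sum_{v\in V(H)}D(v)\ge g(H)$. It is a finite set of points of $\mathbb{Q}^n$, stable under $\mathrm{Aut}(G)$; $\mathbb{Q}[\mathrm{Break}(G)]$ denotes the corresponding permutation module. Orbit harmonics: Let $\mathsf{I}(G)\subseteq\mathbb{Q}[x_1,\dots,x_n]$ be the ideal of polynomials vanishing on $\mathrm{Break}(G)$. For $f\ne0$ let $\tau(f)$ be its homogeneous component of top degree. Then $\mathsf{T}(G)=\langle \tau(f)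 : f\in \mathsf{I}(G),\ f\neq 0\rangle$. Power ideal: For a nonempty proper $S\subset[n]$ the edge cut $\partial(S)$ is the set of edges with one endpoint in $S$ and the other in $[n]\setminus S$, and $d(S)=|\partial(S)|$. A bond is an inclusion-minimal nonempty edge cut (equivalently, for $G$ connected, a cut $\partial(S)$ such that the induced subgraphs on $S$ and on $[n]\setminus S$ are both connected). Put $x_S=\sum_{i\in S}x_i$. Then $\mathcal{I}(G)=\langle x_{[n]},\ x_S^{d(S)} : \partial(S)\text{ a bond of }G\rangle$. Slim subgraph space (central $P$-space): for $Y\subseteq E(G)$ put $p_Y=\prod_{\{i<j\}\in Y}(x_i-x_j)$ (with multiplicity). $Y$ is slim if the graph $([n],E(G)\setminus Y)$ is connected. $\mathcal{P}(G)$ is the $\mathbb{Q}$-linear span of all $p_Y$ with $Y$ slim, graded by polynomial degree; it is stable under the variable-permuting action of $\mathrm{Aut}(G)$. *)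

theory Defs
  imports Complex_Main "HOL-Library.Poly_Mapping" "HOL-Library.Multiset" "HOL-Library.Set_Algebras"
    "HOL-Combinatorics.Permutations"
begin

section \<open>Multigraphs\<close>

text \<open>
  The vertex set \<open>[n]\<close> is the universe of a finite linearly ordered type \<open>'n\<close>, so that
  \<open>n = CARD('n)\<close>. A loopless multigraph is given by its edge multiset, an edge being the
  two-element set of its endpoints. A subgraph is a pair of a vertex set \<open>V\<close> and a
  sub-multiset \<open>F\<close> of edges with both endpoints in \<open>V\<close>.
\<close>

definition loopless :: "'n set multiset \<Rightarrow> bool" where
  "loopless E \<longleftrightarrow> (\<forall>e\<in>#E. card e = 2)"

definition connected_graph :: "'n set \<Rightarrow> 'n set multiset \<Rightarrow> bool" where
  "connected_graph V F \<longleftrightarrow> V \<noteq> {} \<and> (\<forall>u\<in>V. \<forall>v\<in>V. (u, v) \<in> {(a, b). {a, b} \<in># F}\<^sup>*)"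

definition connected_subgraph :: "'n set multiset \<Rightarrow> 'n set \<Rightarrow> 'n set multiset \<Rightarrow> bool" where
  "connected_subgraph E V F \<longleftrightarrow> F \<subseteq># E \<and> (\<forall>e\<in>#F. e \<subseteq> V) \<and> connected_graph V F"

definition genus :: "'n set \<Rightarrow> 'n set multiset \<Rightarrow> int" where
  "genus V F = int (size F) - int (card V) + 1"

definition Aut :: "'n set multiset \<Rightarrow> ('n \<Rightarrow> 'n) set" where
  "Aut E = {\<sigma>. \<sigma> permutes UNIV \<and> (\<forall>i j. count E {\<sigma> i, \<sigma> j} = count E {i, j})}"

definition break_divisors :: "'n::finite set multiset \<Rightarrow> ('n \<Rightarrow> nat) set" where
  "break_divisors E = {D. (\<Sum>v\<in>UNIV. int (D v)) = genus UNIV E \<and>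
     (\<forall>V F. connected_subgraph E V F \<longrightarrow> (\<Sum>v\<in>V. int (D v)) \<ge> genus V F)}"

definition cut :: "'n set multiset \<Rightarrow> 'n set \<Rightarrow> 'n set multiset" where
  "cut E S = {#e \<in># E. e \<inter> S \<noteq> {} \<and> e \<inter> - S \<noteq> {}#}"

definition is_bond :: "'n set multiset \<Rightarrow> 'n set multiset \<Rightarrow> bool" where
  "is_bond E C \<longleftrightarrow> C \<noteq> {#} \<and> (\<exists>S. S \<noteq> {} \<and> S \<noteq> UNIV \<and> C = cut E S) \<and>
     (\<forall>S. S \<noteq> {} \<and> S \<noteq> UNIV \<and> cut E S \<noteq> {#} \<and> cut E S \<subseteq># C \<longrightarrow> cut E S = C)"

definition slim :: "'n set multiset \<Rightarrow> 'n set multiset \<Rightarrow> bool" where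
  "slim E Y \<longleftrightarrow> Y \<subseteq># E \<and> connected_graph UNIV (E - Y)"


section \<open>Polynomials\<close>

text \<open>\<open>\<rat>[x\<^sub>1, \<dots>, x\<^sub>n]\<close>: finitely supported maps from exponent vectors to coefficients.\<close>

type_synonym 'n rpoly = "('n \<Rightarrow>\<^sub>0 nat) \<Rightarrow>\<^sub>0 rat"

definition PConst :: "rat \<Rightarrow> 'n rpoly" where
  "PConst c = Poly_Mapping.single 0 c"

definition PVar :: "'n \<Rightarrow> 'n rpoly" where
  "PVar i = Poly_Mapping.single (Poly_Mapping.single i 1) 1"

definition pscale :: "rat \<Rightarrow> 'n rpoly \<Rightarrow> 'n rpoly" where
  "pscale c f = PConst c * f"

definition poly_eval :: "('n::finite \<Rightarrow> rat) \<Rightarrow> 'n rpoly \<Rightarrow> rat" where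
  "poly_eval a f = (\<Sum>m\<in>Poly_Mapping.keys f. Poly_Mapping.lookup f m *
     (\<Prod>i\<in>UNIV. a i ^ Poly_Mapping.lookup m i))"

definition permute_vars :: "('n::finite \<Rightarrow> 'n) \<Rightarrow> 'n rpoly \<Rightarrow> 'n rpoly" where
  "permute_vars \<sigma> f = (\<Sum>m\<in>Poly_Mapping.keys f. PConst (Poly_Mapping.lookup f m) *
     (\<Prod>i\<in>UNIV. PVar (\<sigma> i) ^ Poly_Mapping.lookup m i))"

definition mdeg :: "('n::finite \<Rightarrow>\<^sub>0 nat) \<Rightarrow> nat" where
  "mdeg m = (\<Sum>i\<in>UNIV. Poly_Mapping.lookup m i)"

definition homogeneous :: "nat \<Rightarrow> 'n::finite rpoly \<Rightarrow> bool" where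
  "homogeneous d f \<longleftrightarrow> (\<forall>m\<in>Poly_Mapping.keys f. mdeg m = d)"

definition hcomponent :: "nat \<Rightarrow> 'n::finite rpoly \<Rightarrow> 'n rpoly" where
  "hcomponent d f = (\<Sum>m\<in>{m \<in> Poly_Mapping.keys f. mdeg m = d}.
     Poly_Mapping.single m (Poly_Mapping.lookup f m))"

definition total_degree :: "'n::finite rpoly \<Rightarrow> nat" where
  "total_degree f = Max (mdeg ` Poly_Mapping.keys f)" \<comment> \<open>only meaningful for \<open>f \<noteq> 0\<close>\<close>

definition top_component :: "'n::finite rpoly \<Rightarrow> 'n rpoly" where
  "top_component f = hcomponent (total_degree f) f"

text \<open>A ring is a module over itself, and the ideal generated by a set is its span there.\<close>

definition ideal_gen :: "'n rpoly set \<Rightarrow> 'n rpoly set" where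
  "ideal_gen = module.span (*)"

definition rat_span :: "'n rpoly set \<Rightarrow> 'n rpoly set" where
  "rat_span = module.span pscale"


section \<open>The ideals and the slim subgraph space of a multigraph\<close>

definition vanishing_ideal :: "'n::finite set multiset \<Rightarrow> 'n rpoly set" where
  "vanishing_ideal E = {f. \<forall>D\<in>break_divisors E. poly_eval (\<lambda>i. of_nat (D i)) f = 0}"

definition T_ideal :: "'n::finite set multiset \<Rightarrow> 'n rpoly set" where
  "T_ideal E = ideal_gen {top_component f | f. f \<in> vanishing_ideal E \<and> f \<noteq> 0}"

definition xsum :: "'n set \<Rightarrow> 'n rpoly" where
  "xsum S = (\<Sum>i\<in>S. PVar i)"

definition power_ideal :: "'n::finite set multiset \<Rightarrow> 'n rpoly set" where
  "power_ideal E = ideal_gen (insert (xsum UNIV)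
     {xsum S ^ size (cut E S) | S. S \<noteq> {} \<and> S \<noteq> UNIV \<and> is_bond E (cut E S)})"

definition p_poly :: "'n::linorder set multiset \<Rightarrow> 'n rpoly" where
  "p_poly Y = (\<Prod>e\<in>#Y. PVar (Min e) - PVar (Max e))"

definition slim_space :: "'n::linorder set multiset \<Rightarrow> 'n rpoly set" where
  "slim_space E = rat_span {p_poly Y | Y. slim E Y}"


section \<open>Modules with an action of a permutation group\<close>

text \<open>
  A \<open>\<rat>\<close>-vector space with carrier \<open>gelems\<close> on which permutations of \<open>'n\<close> act; in the graded case
  \<open>gpart d\<close> is the homogeneous component of degree \<open>d\<close>.
\<close>

record ('n, 'm) gmodule =
  gelems :: "'m set"
  gadd :: "'m \<Rightarrow> 'm \<Rightarrow> 'm"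
  gscale :: "rat \<Rightarrow> 'm \<Rightarrow> 'm"
  gact :: "('n \<Rightarrow> 'n) \<Rightarrow> 'm \<Rightarrow> 'm"

record ('n, 'm) graded_gmodule = "('n, 'm) gmodule" +
  gpart :: "nat \<Rightarrow> 'm set"

definition is_gmodule_iso ::
  "('n \<Rightarrow> 'n) set \<Rightarrow> ('n, 'a, 'x) gmodule_scheme \<Rightarrow> ('n, 'b, 'y) gmodule_scheme \<Rightarrow> ('a \<Rightarrow> 'b) \<Rightarrow> bool"
  where
  "is_gmodule_iso \<Gamma> M N \<phi> \<longleftrightarrow> bij_betw \<phi> (gelems M) (gelems N) \<and>
     (\<forall>u\<in>gelems M. \<forall>v\<in>gelems M. \<phi> (gadd M u v) = gadd N (\<phi> u) (\<phi> v)) \<and>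
     (\<forall>c. \<forall>u\<in>gelems M. \<phi> (gscale M c u) = gscale N c (\<phi> u)) \<and>
     (\<forall>\<sigma>\<in>\<Gamma>. \<forall>u\<in>gelems M. \<phi> (gact M \<sigma> u) = gact N \<sigma> (\<phi> u))"

definition gmodule_isomorphic ::
  "('n \<Rightarrow> 'n) set \<Rightarrow> ('n, 'a, 'x) gmodule_scheme \<Rightarrow> ('n, 'b, 'y) gmodule_scheme \<Rightarrow> bool" where
  "gmodule_isomorphic \<Gamma> M N \<longleftrightarrow> (\<exists>\<phi>. is_gmodule_iso \<Gamma> M N \<phi>)"

definition graded_gmodule_isomorphic ::
  "('n \<Rightarrow> 'n) set \<Rightarrow> ('n, 'a, 'x) graded_gmodule_scheme \<Rightarrow> ('n, 'b, 'y) graded_gmodule_scheme \<Rightarrow> bool"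
  where
  "graded_gmodule_isomorphic \<Gamma> M N \<longleftrightarrow>
     (\<exists>\<phi>. is_gmodule_iso \<Gamma> M N \<phi> \<and> (\<forall>d. \<phi> ` gpart M d = gpart N d))"

text \<open>
  \<open>\<rat>[B]\<close> for a set \<open>B\<close> of points: the basis vector of \<open>D\<close> is \<open>single D 1\<close>, and \<open>\<sigma>\<close> sends \<open>D\<close> to the
  point whose coordinate at \<open>\<sigma> i\<close> is \<open>D i\<close>, in accordance with \<open>\<sigma>\<close> sending \<open>x\<^sub>i\<close> to \<open>x\<^bsub>\<sigma> i\<^esub>\<close>.
\<close>

definition permutation_module :: "('n \<Rightarrow> nat) set \<Rightarrow> ('n, ('n \<Rightarrow> nat) \<Rightarrow>\<^sub>0 rat) gmodule" where
  "permutation_module B =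
    \<lparr>gelems = {a. Poly_Mapping.keys a \<subseteq> B},
     gadd = (+),
     gscale = (\<lambda>c. Poly_Mapping.map ((*) c)),
     gact = (\<lambda>\<sigma> a. \<Sum>D\<in>Poly_Mapping.keys a.
       Poly_Mapping.single (D \<circ> inv \<sigma>) (Poly_Mapping.lookup a D))\<rparr>"

text \<open>
  The quotient of the polynomial ring by an ideal \<open>J\<close>, with cosets \<open>f +o J\<close> as elements. In the
  scalar multiplication \<open>J\<close> is added because \<open>pscale 0 ` A\<close> is \<open>{0}\<close> and not \<open>J\<close>.
\<close>

definition quotient_module :: "'n::finite rpoly set \<Rightarrow> ('n, 'n rpoly set) graded_gmodule" where
  "quotient_module J =
    \<lparr>gelems = {f +o J | f. True},
     gadd = (+),
     gscale = (\<lambda>c A. pscale c ` A + J),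
     gact = (\<lambda>\<sigma> A. permute_vars \<sigma> ` A),
     gpart = (\<lambda>d. {f +o J | f. homogeneous d f})\<rparr>"

definition polynomial_submodule :: "'n::finite rpoly set \<Rightarrow> ('n, 'n rpoly) graded_gmodule" where
  "polynomial_submodule P =
    \<lparr>gelems = P,
     gadd = (+),
     gscale = pscale,
     gact = permute_vars,
     gpart = (\<lambda>d. {f \<in> P. homogeneous d f})\<rparr>"


section \<open>Well-definedness\<close>

lemma module_times: "module ((*) :: 'a::comm_ring_1 \<Rightarrow> 'a \<Rightarrow> 'a)"
  by unfold_locales (simp_all add: algebra_simps)

lemma PConst_mult: "PConst (a * b) = PConst a * PConst b"
  by (simp add: PConst_def mult_single)

lemma PConst_add: "PConst (a + b) = PConst a + PConst b"
  by (simp add: PConst_def single_add)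

lemma PConst_1: "PConst 1 = 1"
  by (simp add: PConst_def)

lemma vector_space_pscale: "vector_space pscale"
  by unfold_locales (simp_all add: pscale_def PConst_mult PConst_add PConst_1 algebra_simps)

lemma ideal_gen_closed:
  shows ideal_gen_0: "0 \<in> ideal_gen S"
    and ideal_gen_add: "f \<in> ideal_gen S \<Longrightarrow> g \<in> ideal_gen S \<Longrightarrow> f + g \<in> ideal_gen S"
    and ideal_gen_mult: "f \<in> ideal_gen S \<Longrightarrow> h * f \<in> ideal_gen S"
  unfolding ideal_gen_def
  by (simp_all add: module.span_zero[OF module_times] module.span_add[OF module_times]
      module.span_scale[OF module_times])

lemma quotient_add:
  "gadd (quotient_module (ideal_gen S)) (f +o ideal_gen S) (g +o ideal_gen S) = (f + g) +o ideal_gen S"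
proof -
  have "ideal_gen S + ideal_gen S = ideal_gen S"
    using ideal_gen_add[of _ S] ideal_gen_0[of S] by (force simp: set_plus_def)
  then show ?thesis
    by (simp add: quotient_module_def set_plus_rearrange)
qed

lemma quotient_scale:
  "gscale (quotient_module (ideal_gen S)) c (f +o ideal_gen S) = pscale c f +o ideal_gen S"
proof -
  have "pscale c (f + s) + t = pscale c f + (pscale c s + t)" for s t :: "'a rpoly"
    by (simp add: pscale_def algebra_simps)
  moreover have "pscale c s + t \<in> ideal_gen S" if "s \<in> ideal_gen S" "t \<in> ideal_gen S" for s t
    using that by (simp add: pscale_def ideal_gen_add ideal_gen_mult)
  moreover have "pscale c 0 + t = t" for t :: "'a rpoly"
    by (simp add: pscale_def)
  ultimately show ?thesis
    using ideal_gen_0[of S]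
    by (auto simp: quotient_module_def elt_set_plus_def set_plus_def image_iff; metis)
qed

lemma permute_vars_add: "permute_vars \<sigma> (f + g) = permute_vars \<sigma> f + permute_vars \<sigma> g"
proof -
  let ?K = "Poly_Mapping.keys f \<union> Poly_Mapping.keys g"
  let ?M = "\<lambda>m. \<Prod>i\<in>UNIV. PVar (\<sigma> i) ^ Poly_Mapping.lookup m i"
  have K: "permute_vars \<sigma> h = (\<Sum>m\<in>?K. PConst (Poly_Mapping.lookup h m) * ?M m)"
    if "Poly_Mapping.keys h \<subseteq> ?K" for h
    unfolding permute_vars_def using that
    by (intro sum.mono_neutral_left) (auto simp: in_keys_iff PConst_def)
  have "permute_vars \<sigma> (f + g) = (\<Sum>m\<in>?K. PConst (Poly_Mapping.lookup (f + g) m) * ?M m)"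
    by (rule K[OF keys_add])
  also have "\<dots> = (\<Sum>m\<in>?K. PConst (Poly_Mapping.lookup f m) * ?M m)
      + (\<Sum>m\<in>?K. PConst (Poly_Mapping.lookup g m) * ?M m)"
    by (simp add: lookup_add PConst_add distrib_right sum.distrib)
  also have "\<dots> = permute_vars \<sigma> f + permute_vars \<sigma> g"
    by (simp add: K[of f] K[of g])
  finally show ?thesis .
qed

lemma permute_vars_PVar: "permute_vars \<sigma> (PVar i) = PVar (\<sigma> i)"
proof -
  have "permute_vars \<sigma> (PVar i) =
      (\<Prod>j\<in>UNIV. PVar (\<sigma> j) ^ Poly_Mapping.lookup (Poly_Mapping.single i (1::nat)) j)"
    by (simp add: permute_vars_def PVar_def PConst_1)
  also have "\<dots> = (\<Prod>j\<in>UNIV. if i = j then PVar (\<sigma> j) else 1)"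
    by (intro prod.cong) (auto simp: lookup_single when_def)
  finally show ?thesis by simp
qed

lemma quotient_act:
  assumes "permute_vars \<sigma> ` J = J"
  shows "gact (quotient_module J) \<sigma> (f +o J) = permute_vars \<sigma> f +o J"
proof -
  have "permute_vars \<sigma> ` (f +o J) = permute_vars \<sigma> f +o (permute_vars \<sigma> ` J)"
    by (auto simp: elt_set_plus_def permute_vars_add[symmetric])
  then show ?thesis
    by (simp add: assms quotient_module_def)
qed

end

theory Submission
  imports Defs
begin

text \<open>
  Write \<open>I\<close> for the power ideal, \<open>T\<close> for the ideal of top components, \<open>P\<close> for the slim subgraph space
  and \<open>V\<close> for the ideal of polynomials that vanish on the break divisors. The proof compares them
  through one positive definite form on the polynomial ring: \<open>pairing f g\<close> is the constant term of
  \<open>f(\<partial>) g\<close>, so monomials are orthogonal and multiplication by \<open>x\<^sub>i\<close> is adjoint to \<open>\<partial>\<^sub>i\<close>. An element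
  is orthogonal to an ideal iff the differential operators \<open>g(\<partial>)\<close>, \<open>g\<close> in the ideal, annihilate it. The
  equality \<open>T = I\<close> comes from the circle \<open>T \<subseteq> P\<^sup>\<bottom> = I \<subseteq> T\<close>; no dimension is ever computed.

  \<open>I \<subseteq> P\<^sup>\<bottom>\<close> (\<open>power_ideal_pairing_slim\<close>): a slim \<open>Y\<close> misses an edge of every cut, so along the
  indicator vector of \<open>S\<close> the product \<open>p\<^sub>Y\<close> has degree less than \<open>d(S)\<close>.

  \<open>P\<^sup>\<bottom> \<subseteq> I\<close> (\<open>power_ideal_eq_orthogonal\<close>): projecting on \<open>I\<close> in each degree reduces this to
  \<open>I\<^sup>\<bottom> \<subseteq> P\<close>, that is, to \<open>cut_annihilated_imp_arc_space\<close>: if the \<open>d(S)\<close>-th derivative of \<open>f\<close> along \<open>S\<close>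
  vanishes for every cut, and its first derivative along the whole vertex set does, then \<open>f \<in> P\<close>. The proof is by deletion and contraction of an edge \<open>{i, j}\<close>.
  Restricted to the hyperplane \<open>x\<^sub>i = x\<^sub>j\<close>, \<open>f\<close> satisfies the hypothesis for the contraction; the
  expression found there lifts to some \<open>p \<in> P\<close>, and \<open>f - p = (x\<^sub>i - x\<^sub>j) h\<close>. The factor \<open>x\<^sub>i - x\<^sub>j\<close>
  raises the degree along \<open>S\<close> by one exactly when \<open>S\<close> separates \<open>i\<close> from \<open>j\<close>, and these are the \<open>S\<close>
  whose cut loses an edge in the deletion; hence \<open>h\<close> satisfies the hypothesis for the deletion, or is
  zero if the edge is a bridge. Here all
  cuts are needed, while \<open>I\<close> is generated by bonds; \<open>xsum_power_in_power_ideal\<close> bridges the gap.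

  \<open>T \<subseteq> P\<^sup>\<bottom>\<close> (\<open>T_ideal_subset_power_ideal\<close>): for slim \<open>Y\<close> there is a spanning tree outside \<open>Y\<close>, and
  moving each edge off the tree to one of its endpoints gives a break divisor. Letting the edges of \<open>Y\<close>
  choose freely, with signs, produces an iterated difference operator. Applied to a polynomial of degree
  \<open>|Y|\<close> it equals \<open>p\<^sub>Y(\<partial>)\<close> of the top component, so it yields \<open>pairing p\<^sub>Y (top f)\<close>; and it is zero when
  \<open>f \<in> V\<close>.

  \<open>I \<subseteq> T\<close> (\<open>power_gens_lift\<close>): for a bond, the genus inequalities of the two sides confine \<open>D(S)\<close> to
  \<open>d(S)\<close> consecutive integers \<open>c\<close>; the product of the \<open>x\<^sub>S - c\<close> is in \<open>V\<close> and has top component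
  \<open>x\<^sub>S\<close> to the power \<open>d(S)\<close>.

  Now the polynomial ring is the direct sum of the graded \<open>Aut\<close>-stable subspaces \<open>P\<close> and \<open>I\<close>, which
  gives the graded isomorphism of the quotient with \<open>P\<close>. Evaluation maps \<open>P\<close> bijectively onto the
  functions on the break divisors: the top component of an element of \<open>P \<inter> V\<close> lies in \<open>P \<inter> T = 0\<close>, and
  an interpolating polynomial can be moved into \<open>P\<close> modulo \<open>V\<close> by lowering the degree of the remainder
  (\<open>slim_space_vanishing_ideal_decomposition\<close>).
\<close>

section \<open>Polynomials as linear combinations of monomials\<close>

interpretation Q: vector_space pscale
  by (rule vector_space_pscale)

lemma lookup_PConst_mult: "Poly_Mapping.lookup (PConst c * f) m = c * Poly_Mapping.lookup f m"
  by (simp add: PConst_def mult_map_scale_conv_mult[symmetric] Poly_Mapping.map.rep_eq when_def)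

lemma lookup_pscale [simp]: "Poly_Mapping.lookup (pscale c f) m = c * Poly_Mapping.lookup f m"
  by (simp add: pscale_def lookup_PConst_mult)

lemma PConst_0 [simp]: "PConst 0 = 0"
  by (simp add: PConst_def)

lemma PConst_uminus: "PConst (- c) = - PConst c"
  by (simp add: PConst_def single_uminus)

lemma PConst_mult_single: "PConst c * Poly_Mapping.single m d = Poly_Mapping.single m (c * d)"
  by (simp add: PConst_def mult_single)

lemma sum_keys_superset:
  assumes "finite K" "Poly_Mapping.keys f \<subseteq> K" "\<And>m. G m 0 = 0"
  shows "(\<Sum>m\<in>Poly_Mapping.keys f. G m (Poly_Mapping.lookup f m)) = (\<Sum>m\<in>K. G m (Poly_Mapping.lookup f m))"
  using assms by (intro sum.mono_neutral_left) (auto simp: in_keys_iff)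

text \<open>
  The tool for everything that is defined by a sum over the keys of a polynomial (insertion, pairing,
  partial derivatives): such a definition is additive as soon as its summand is additive in the
  coefficient.
\<close>

lemma sum_keys_add:
  assumes "\<And>m. G m 0 = 0" "\<And>m a b. G m (a + b) = G m a + (G m b :: 'b::comm_monoid_add)"
  shows "(\<Sum>m\<in>Poly_Mapping.keys (f + g). G m (Poly_Mapping.lookup (f + g) m)) =
    (\<Sum>m\<in>Poly_Mapping.keys f. G m (Poly_Mapping.lookup f m)) +
    (\<Sum>m\<in>Poly_Mapping.keys g. G m (Poly_Mapping.lookup g m))"
proof -
  let ?K = "Poly_Mapping.keys f \<union> Poly_Mapping.keys g"
  have "finite ?K" by simp
  show ?thesis
    using sum_keys_superset[OF \<open>finite ?K\<close> keys_add, of G] sum_keys_superset[OF \<open>finite ?K\<close>, of f G]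
      sum_keys_superset[OF \<open>finite ?K\<close>, of g G] assms
    by (simp add: lookup_add sum.distrib)
qed

lemma rpoly_sum_single: "(\<Sum>m\<in>Poly_Mapping.keys f. Poly_Mapping.single m (Poly_Mapping.lookup f m)) = f"
proof (rule poly_mapping_eqI)
  fix k
  show "Poly_Mapping.lookup (\<Sum>m\<in>Poly_Mapping.keys f. Poly_Mapping.single m (Poly_Mapping.lookup f m)) k
    = Poly_Mapping.lookup f k"
    by (simp add: lookup_sum lookup_single when_def in_keys_iff)
qed

lemma poly_mapping_additive_induct [case_names single add]:
  assumes "\<And>m c. P (Poly_Mapping.single m c)" "\<And>f g. P f \<Longrightarrow> P g \<Longrightarrow> P (f + g)"
  shows "P (f :: 'a \<Rightarrow>\<^sub>0 'b::comm_monoid_add)"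
proof -
  have z: "P 0" using assms(1)[of _ 0] by simp
  have "P (\<Sum>m\<in>K. Poly_Mapping.single m (Poly_Mapping.lookup f m))" if "finite K" for K
    using that by (induction K) (auto intro: assms z)
  from this[of "Poly_Mapping.keys f"] show ?thesis
    by (simp add: rpoly_sum_single)
qed

lemma mdeg_zero [simp]: "mdeg 0 = 0"
  by (simp add: mdeg_def)

lemma mdeg_add [simp]: "mdeg (m + n) = mdeg m + mdeg n"
  by (simp add: mdeg_def lookup_add sum.distrib)

lemma mdeg_single [simp]: "mdeg (Poly_Mapping.single i k) = k"
  by (simp add: mdeg_def lookup_single when_def)

lemma mdeg_eq_0_iff [simp]: "mdeg m = 0 \<longleftrightarrow> m = 0"
  by (auto simp: mdeg_def intro: poly_mapping_eqI)

lemma exponent_split: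
  assumes "Poly_Mapping.lookup m i > 0"
  shows "m = Poly_Mapping.single i (1::nat) + (m - Poly_Mapping.single i 1)"
  by (rule poly_mapping_eqI) (use assms in \<open>auto simp: lookup_add lookup_minus lookup_single when_def\<close>)

lemma exponent_nonzero_ex: "m \<noteq> 0 \<Longrightarrow> \<exists>i. Poly_Mapping.lookup m i > (0::nat)"
  by (metis neq0_conv lookup_zero poly_mapping_eqI)

lemma PVar_mult_single:
  "PVar i * Poly_Mapping.single m c = Poly_Mapping.single (Poly_Mapping.single i 1 + m) c"
  by (simp add: PVar_def mult_single)

text \<open>
  The induction for identities between ring homomorphisms and derivations, where multiplication by one
  variable is the only product that has to be understood.
\<close>

lemma rpoly_induct [case_names const add var]:
  fixes f :: "'n::finite rpoly"
  assumes const: "\<And>c. P (PConst c)"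
    and add: "\<And>f g. P f \<Longrightarrow> P g \<Longrightarrow> P (f + g)"
    and var: "\<And>i f. P f \<Longrightarrow> P (PVar i * f)"
  shows "P f"
proof (induction f rule: poly_mapping_additive_induct)
  case (single m c)
  show ?case
  proof (induction "mdeg m" arbitrary: m)
    case 0
    then show ?case using const[of c] by (simp add: PConst_def)
  next
    case (Suc k)
    then have "m \<noteq> 0" by auto
    then obtain i where i: "Poly_Mapping.lookup m i > 0"
      using exponent_nonzero_ex by blast
    let ?m = "m - Poly_Mapping.single i 1"
    have m: "m = Poly_Mapping.single i 1 + ?m" by (rule exponent_split[OF i])
    have "mdeg m = 1 + mdeg ?m" by (subst m) simp
    with Suc have "P (Poly_Mapping.single ?m c)" by simp
    from var[OF this, of i] show ?case
      using m by (simp add: PVar_mult_single)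
  qed
qed (rule add)

section \<open>Evaluation and substitution\<close>

text \<open>
  Evaluation, substitution of variables and translation are instances of one construction, the
  extension of a homomorphism \<open>c\<close> on the coefficients by values of the variables; multiplicativity is
  proved once, here.
\<close>

locale rat_hom =
  fixes c :: "rat \<Rightarrow> 'b::comm_ring_1"
  assumes hom_add: "c (a + b) = c a + c b"
    and hom_mult: "c (a * b) = c a * c b"
    and hom_one: "c 1 = 1"
begin

definition insertion :: "('n::finite \<Rightarrow> 'b) \<Rightarrow> 'n rpoly \<Rightarrow> 'b" where
  "insertion a f = (\<Sum>m\<in>Poly_Mapping.keys f. c (Poly_Mapping.lookup f m) *
     (\<Prod>i\<in>UNIV. a i ^ Poly_Mapping.lookup m i))"

lemma hom_zero: "c 0 = 0"
  using hom_add[of 0 0] by simp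

lemma insertion_add: "insertion a (f + g) = insertion a f + insertion a g"
  unfolding insertion_def by (rule sum_keys_add) (simp_all add: hom_zero hom_add distrib_right)

lemma insertion_single:
  "insertion a (Poly_Mapping.single m x) = c x * (\<Prod>i\<in>UNIV. a i ^ Poly_Mapping.lookup m i)"
  by (simp add: insertion_def hom_zero)

lemma insertion_mult: "insertion a (f * g) = insertion a f * insertion a g"
proof (induction f rule: poly_mapping_additive_induct)
  case (single m x)
  show ?case
  proof (induction g rule: poly_mapping_additive_induct)
    case (single n y)
    show ?case
      unfolding mult_single insertion_single hom_mult lookup_add power_add prod.distrib
      by (simp only: mult.assoc mult.left_commute)
  next
    case (add f g)
    then show ?case by (simp only: distrib_left insertion_add)
  qed
qed (simp add: insertion_add distrib_right)

lemma insertion_PConst: "insertion a (PConst x) = c x"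
  by (simp add: PConst_def insertion_single)

lemma insertion_PVar: "insertion a (PVar i) = a i"
proof -
  have "(\<Prod>j\<in>UNIV. a j ^ Poly_Mapping.lookup (Poly_Mapping.single i (1::nat)) j) =
      (\<Prod>j\<in>UNIV. if i = j then a j else 1)"
    by (intro prod.cong) (auto simp: lookup_single when_def)
  then show ?thesis by (simp add: PVar_def insertion_single hom_one)
qed

end

interpretation eval: rat_hom "\<lambda>x. x"
  by unfold_locales simp_all

interpretation subst: rat_hom PConst
  by unfold_locales (simp_all add: PConst_add PConst_mult PConst_1)

lemma poly_eval_insertion: "poly_eval = eval.insertion"
  by (simp add: poly_eval_def eval.insertion_def fun_eq_iff)

lemma permute_vars_insertion: "permute_vars \<sigma> = subst.insertion (\<lambda>i. PVar (\<sigma> i))"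
  by (simp add: permute_vars_def subst.insertion_def fun_eq_iff)

lemma poly_eval_simps [simp]:
  "poly_eval a (f + g) = poly_eval a f + poly_eval a g"
  "poly_eval a (f * g) = poly_eval a f * poly_eval a g"
  "poly_eval a (PConst x) = x"
  "poly_eval a (PVar i) = a i"
  "poly_eval a 0 = 0"
  "poly_eval a 1 = 1"
  using eval.insertion_PConst[of a 0] eval.insertion_PConst[of a 1]
  by (simp_all add: poly_eval_insertion eval.insertion_add eval.insertion_mult
      eval.insertion_PConst eval.insertion_PVar PConst_1)

lemma poly_eval_more [simp]:
  "poly_eval a (- f) = - poly_eval a f"
  "poly_eval a (f - g) = poly_eval a f - poly_eval a g"
  "poly_eval a (pscale x f) = x * poly_eval a f"
proof -
  show u: "poly_eval a (- f) = - poly_eval a f" for f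
    using poly_eval_simps(1)[of a f "- f"] by (simp del: poly_eval_simps(1))
  show "poly_eval a (f - g) = poly_eval a f - poly_eval a g"
    using poly_eval_simps(1)[of a f "- g"] by (simp add: u del: poly_eval_simps(1))
qed (simp add: pscale_def)

lemma poly_eval_sum [simp]: "poly_eval a (sum f K) = (\<Sum>k\<in>K. poly_eval a (f k))"
  by (induction K rule: infinite_finite_induct) simp_all

lemma poly_eval_prod [simp]: "poly_eval a (prod f K) = (\<Prod>k\<in>K. poly_eval a (f k))"
  by (induction K rule: infinite_finite_induct) simp_all

lemma poly_eval_xsum [simp]: "poly_eval a (xsum S) = sum a S"
  by (simp add: xsum_def)

lemma permute_vars_simps [simp]:
  "permute_vars \<sigma> (f + g) = permute_vars \<sigma> f + permute_vars \<sigma> g"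
  "permute_vars \<sigma> (f * g) = permute_vars \<sigma> f * permute_vars \<sigma> g"
  "permute_vars \<sigma> (PConst x) = PConst x"
  "permute_vars \<sigma> (PVar i) = PVar (\<sigma> i)"
  "permute_vars \<sigma> 0 = 0"
  "permute_vars \<sigma> 1 = 1"
  using subst.insertion_PConst[of "\<lambda>i. PVar (\<sigma> i)" 0] subst.insertion_PConst[of "\<lambda>i. PVar (\<sigma> i)" 1]
  by (simp_all add: permute_vars_insertion subst.insertion_add subst.insertion_mult
      subst.insertion_PConst subst.insertion_PVar PConst_1)

lemma permute_vars_more [simp]:
  "permute_vars \<sigma> (- f) = - permute_vars \<sigma> f"
  "permute_vars \<sigma> (f - g) = permute_vars \<sigma> f - permute_vars \<sigma> g"
  "permute_vars \<sigma> (pscale x f) = pscale x (permute_vars \<sigma> f)"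
proof -
  show u: "permute_vars \<sigma> (- f) = - permute_vars \<sigma> f" for f :: "'a rpoly"
    using permute_vars_simps(1)[of \<sigma> f "- f"] by (simp add: eq_neg_iff_add_eq_0 add.commute del: permute_vars_simps(1))
  show "permute_vars \<sigma> (f - g) = permute_vars \<sigma> f - permute_vars \<sigma> g"
    using permute_vars_simps(1)[of \<sigma> f "- g"] by (simp add: u del: permute_vars_simps(1))
qed (simp add: pscale_def)

lemma permute_vars_sum [simp]: "permute_vars \<sigma> (sum f K) = (\<Sum>k\<in>K. permute_vars \<sigma> (f k))"
  by (induction K rule: infinite_finite_induct) simp_all

lemma permute_vars_power [simp]: "permute_vars \<sigma> (f ^ k) = permute_vars \<sigma> f ^ k"
  by (induction k) simp_all

lemma permute_vars_comp: "permute_vars \<sigma> (permute_vars \<tau> f) = permute_vars (\<sigma> \<circ> \<tau>) f"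
  by (induction f rule: rpoly_induct) simp_all

lemma permute_vars_id [simp]: "permute_vars id f = f"
  by (induction f rule: rpoly_induct) simp_all

lemma poly_eval_permute_vars: "poly_eval a (permute_vars \<sigma> f) = poly_eval (a \<circ> \<sigma>) f"
  by (induction f rule: rpoly_induct) simp_all

lemma permute_vars_xsum:
  assumes "inj \<sigma>"
  shows "permute_vars \<sigma> (xsum S) = xsum (\<sigma> ` S)"
  using assms by (simp add: xsum_def sum.reindex inj_on_subset)

text \<open>
  Substituting \<open>x\<^sub>j\<close> for \<open>x\<^sub>i\<close> is reduction modulo \<open>x\<^sub>i - x\<^sub>j\<close>. This turns equality on the hyperplane
  \<open>x\<^sub>i = x\<^sub>j\<close> into divisibility.
\<close>

lemma identify_vars_cong:
  "\<exists>h. f - permute_vars (\<lambda>k. if k = i then j else k) f = (PVar i - PVar j) * h"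
proof (induction f rule: rpoly_induct)
  case (const c)
  show ?case by (rule exI[of _ 0]) simp
next
  case (add f g)
  let ?r = "permute_vars (\<lambda>k. if k = i then j else k)"
  obtain h h' where "f - ?r f = (PVar i - PVar j) * h" "g - ?r g = (PVar i - PVar j) * h'"
    using add by blast
  moreover have "f + g - ?r (f + g) = (f - ?r f) + (g - ?r g)" by simp
  ultimately have "f + g - ?r (f + g) = (PVar i - PVar j) * (h + h')" by (simp only: distrib_left)
  then show ?case by blast
next
  case (var k f)
  let ?r = "permute_vars (\<lambda>k. if k = i then j else k)"
  obtain h where h: "f - ?r f = (PVar i - PVar j) * h" using var by blast
  show ?case
  proof (cases "k = i")
    case True
    have "PVar i * f - PVar j * ?r f = (PVar i - PVar j) * f + PVar j * (f - ?r f)"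
      by (simp add: left_diff_distrib right_diff_distrib)
    also have "\<dots> = (PVar i - PVar j) * (f + PVar j * h)"
      unfolding h by (simp only: distrib_left mult.left_commute)
    finally have "PVar i * f - PVar j * ?r f = (PVar i - PVar j) * (f + PVar j * h)" .
    then show ?thesis using True by auto
  next
    case False
    have "PVar k * f - PVar k * ?r f = PVar k * (f - ?r f)"
      by (simp add: right_diff_distrib)
    also have "\<dots> = (PVar i - PVar j) * (PVar k * h)"
      unfolding h by (rule mult.left_commute)
    finally have "PVar k * f - PVar k * ?r f = (PVar i - PVar j) * (PVar k * h)" .
    then show ?thesis using False by auto
  qed
qed

section \<open>Homogeneous components\<close>

lemma lookup_hcomponent [simp]:
  "Poly_Mapping.lookup (hcomponent d f) m = (if mdeg m = d then Poly_Mapping.lookup f m else 0)"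
  by (simp add: hcomponent_def lookup_sum lookup_single when_def in_keys_iff)

lemma hcomponent_linear [simp]:
  "hcomponent d (f + g) = hcomponent d f + hcomponent d g"
  "hcomponent d (f - g) = hcomponent d f - hcomponent d g"
  "hcomponent d (- f) = - hcomponent d f"
  "hcomponent d 0 = 0"
  "hcomponent d (pscale c f) = pscale c (hcomponent d f)"
  by (rule poly_mapping_eqI; simp add: lookup_add lookup_minus)+

lemma homogeneous_hcomponent [simp]: "homogeneous d (hcomponent d f)"
  by (auto simp: homogeneous_def in_keys_iff split: if_splits)

lemma homogeneous_lookup: "homogeneous d f \<longleftrightarrow> (\<forall>m. mdeg m \<noteq> d \<longrightarrow> Poly_Mapping.lookup f m = 0)"
  by (auto simp: homogeneous_def in_keys_iff)

lemma hcomponent_homogeneous: "homogeneous k f \<Longrightarrow> hcomponent d f = (if d = k then f else 0)"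
  by (auto simp: homogeneous_lookup intro!: poly_mapping_eqI)

lemma homogeneous_linear:
  "homogeneous d 0"
  "homogeneous d f \<Longrightarrow> homogeneous d g \<Longrightarrow> homogeneous d (f + g)"
  "homogeneous d f \<Longrightarrow> homogeneous d g \<Longrightarrow> homogeneous d (f - g)"
  "homogeneous d f \<Longrightarrow> homogeneous d (pscale c f)"
  by (auto simp: homogeneous_lookup lookup_add lookup_minus)

lemma homogeneous_sum: "(\<And>k. k \<in> K \<Longrightarrow> homogeneous d (f k)) \<Longrightarrow> homogeneous d (sum f K)"
  by (induction K rule: infinite_finite_induct) (simp_all add: homogeneous_linear)

lemma homogeneous_mult: "homogeneous a f \<Longrightarrow> homogeneous b g \<Longrightarrow> homogeneous (a + b) (f * g)"
  using keys_mult[of f g] by (fastforce simp: homogeneous_def)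

lemma homogeneous_PVar: "homogeneous 1 (PVar i)"
  by (simp add: homogeneous_def PVar_def)

lemma homogeneous_1: "homogeneous 0 1"
  by (simp add: homogeneous_def)

lemma homogeneous_xsum: "homogeneous 1 (xsum S)"
  unfolding xsum_def by (intro homogeneous_sum homogeneous_PVar)

lemma homogeneous_power: "homogeneous a f \<Longrightarrow> homogeneous (a * k) (f ^ k)"
  by (induction k) (simp_all add: homogeneous_1 homogeneous_mult)

text \<open>
  Hence an ideal that is generated by homogeneous elements contains the homogeneous components of its
  elements.
\<close>

lemma hcomponent_mult_homogeneous:
  assumes "homogeneous k g"
  shows "hcomponent d (h * g) = (if k \<le> d then hcomponent (d - k) h * g else 0)"
proof (induction h rule: poly_mapping_additive_induct)
  case (single m c)
  have h: "homogeneous (mdeg m) (Poly_Mapping.single m c)" by (simp add: homogeneous_def)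
  show ?case
    using homogeneous_mult[OF h assms] h by (auto simp: hcomponent_homogeneous)
qed (simp add: distrib_right)

text \<open>
  A strict bound covers the zero polynomial without a convention for its degree: \<open>degree_less 0 f\<close>
  means \<open>f = 0\<close>.
\<close>

definition degree_less :: "nat \<Rightarrow> 'n::finite rpoly \<Rightarrow> bool" where
  "degree_less k f \<longleftrightarrow> (\<forall>m. mdeg m \<ge> k \<longrightarrow> Poly_Mapping.lookup f m = 0)"

lemma degree_less_0 [simp]: "degree_less 0 f \<longleftrightarrow> f = 0"
  by (auto simp: degree_less_def intro: poly_mapping_eqI)

lemma degree_less_mono: "degree_less k f \<Longrightarrow> k \<le> l \<Longrightarrow> degree_less l f"
  by (simp add: degree_less_def)

lemma degree_less_linear:
  "degree_less k 0"
  "degree_less k f \<Longrightarrow> degree_less k g \<Longrightarrow> degree_less k (f + g)"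
  "degree_less k f \<Longrightarrow> degree_less k g \<Longrightarrow> degree_less k (f - g)"
  "degree_less k f \<Longrightarrow> degree_less k (pscale c f)"
  by (auto simp: degree_less_def lookup_add lookup_minus)

lemma degree_less_sum: "(\<And>x. x \<in> K \<Longrightarrow> degree_less d (f x)) \<Longrightarrow> degree_less d (sum f K)"
  by (induction K rule: infinite_finite_induct) (simp_all add: degree_less_linear)

lemma degree_less_keys: "degree_less k f \<longleftrightarrow> (\<forall>m\<in>Poly_Mapping.keys f. mdeg m < k)"
  unfolding degree_less_def Ball_def in_keys_iff by (meson not_less)

lemma degree_less_ex: "\<exists>k. degree_less k f"
proof -
  have "mdeg m < Suc (\<Sum>m\<in>Poly_Mapping.keys f. mdeg m)" if "m \<in> Poly_Mapping.keys f" for m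
    using member_le_sum[of m "Poly_Mapping.keys f" mdeg] that by simp
  then show ?thesis unfolding degree_less_keys by blast
qed

lemma sum_hcomponents: "degree_less N f \<Longrightarrow> (\<Sum>d<N. hcomponent d f) = f"
  by (rule poly_mapping_eqI) (auto simp: lookup_sum degree_less_def not_less)

lemma degree_less_homogeneous: "homogeneous d f \<Longrightarrow> d < k \<Longrightarrow> degree_less k f"
  by (auto simp: degree_less_def homogeneous_lookup)

lemma degree_less_mult:
  assumes "degree_less (Suc a) f" "degree_less b g"
  shows "degree_less (a + b) (f * g)"
  using assms keys_mult[of f g] by (fastforce simp: degree_less_keys)

lemma degree_less_hcomponent: "degree_less (Suc d) f \<Longrightarrow> degree_less d (f - hcomponent d f)"
  by (auto simp: degree_less_def lookup_minus)

text \<open>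
  Top components are recognised by splitting off a nonzero homogeneous part, which avoids the maximum
  in the definition of the total degree.
\<close>

lemma top_component_eq:
  assumes "homogeneous d u" "u \<noteq> 0" "degree_less d (f - u)"
  shows "f \<noteq> 0" "top_component f = u"
proof -
  have l: "Poly_Mapping.lookup f m = Poly_Mapping.lookup u m" if "mdeg m \<ge> d" for m
    using assms(3) that by (simp add: degree_less_def lookup_minus)
  obtain m where m: "Poly_Mapping.lookup u m \<noteq> 0" using assms(2) by (metis lookup_zero poly_mapping_eqI)
  then have md: "mdeg m = d" using assms(1) by (auto simp: homogeneous_lookup)
  with m l[of m] have mf: "m \<in> Poly_Mapping.keys f" by (simp add: in_keys_iff)
  then show "f \<noteq> 0" by auto
  have "mdeg m' \<le> d" if "m' \<in> Poly_Mapping.keys f" for m'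
    using that l[of m'] assms(1) by (force simp: in_keys_iff homogeneous_lookup)
  then have "total_degree f = d"
    unfolding total_degree_def using mf md by (intro Max_eqI) auto
  then show "top_component f = u"
    using l assms(1) by (auto simp: top_component_def homogeneous_lookup intro!: poly_mapping_eqI)
qed

lemma top_component_split:
  assumes "f \<noteq> 0"
  shows "homogeneous (total_degree f) (top_component f)" "top_component f \<noteq> 0"
    "degree_less (Suc (total_degree f)) f"
proof -
  have fin: "finite (mdeg ` Poly_Mapping.keys f)" by simp
  have "mdeg ` Poly_Mapping.keys f \<noteq> {}" using assms by simp
  then have "total_degree f \<in> mdeg ` Poly_Mapping.keys f"
    unfolding total_degree_def using Max_in[OF fin] by blast
  then obtain m where "m \<in> Poly_Mapping.keys f" "mdeg m = total_degree f" by auto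
  then have "Poly_Mapping.lookup (top_component f) m \<noteq> 0"
    by (simp add: top_component_def in_keys_iff)
  then show "top_component f \<noteq> 0" by auto
  show "homogeneous (total_degree f) (top_component f)" by (simp add: top_component_def)
  show "degree_less (Suc (total_degree f)) f"
    using Max_ge[OF fin] by (auto simp: degree_less_keys total_degree_def less_Suc_eq_le)
qed

section \<open>The differentiation pairing\<close>

text \<open>
  The form \<open>pairing f g\<close> is the constant term of \<open>f(\<partial>) g\<close>; the weight is \<open>m! = m\<^sub>1! \<cdots> m\<^sub>n!\<close>, since
  \<open>\<partial>\<^sup>m x\<^sup>m = m!\<close>.
\<close>

definition exponent_fact :: "('n::finite \<Rightarrow>\<^sub>0 nat) \<Rightarrow> rat" where
  "exponent_fact m = (\<Prod>i\<in>UNIV. fact (Poly_Mapping.lookup m i))"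

definition pairing :: "'n::finite rpoly \<Rightarrow> 'n rpoly \<Rightarrow> rat" where
  "pairing f g = (\<Sum>m\<in>Poly_Mapping.keys f.
     Poly_Mapping.lookup f m * (Poly_Mapping.lookup g m * exponent_fact m))"

lemma exponent_fact_pos: "exponent_fact m > 0"
  by (simp add: exponent_fact_def prod_pos)

lemma pairing_commute: "pairing f g = pairing g f"
proof -
  let ?K = "Poly_Mapping.keys f \<union> Poly_Mapping.keys g"
  have "pairing f g = (\<Sum>m\<in>?K. Poly_Mapping.lookup f m * (Poly_Mapping.lookup g m * exponent_fact m))"
    unfolding pairing_def by (rule sum_keys_superset) auto
  also have "\<dots> = (\<Sum>m\<in>?K. Poly_Mapping.lookup g m * (Poly_Mapping.lookup f m * exponent_fact m))"
    by (simp add: mult.left_commute)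
  also have "\<dots> = pairing g f"
    unfolding pairing_def by (rule sum_keys_superset[symmetric]) auto
  finally show ?thesis .
qed

lemma pairing_add_left: "pairing (f + g) h = pairing f h + pairing g h"
  unfolding pairing_def
  by (rule sum_keys_add[where G = "\<lambda>m x. x * (Poly_Mapping.lookup h m * exponent_fact m)"])
    (simp_all add: distrib_right)

lemma pairing_add_right: "pairing h (f + g) = pairing h f + pairing h g"
  by (metis pairing_add_left pairing_commute)

lemma pairing_scale_right [simp]: "pairing f (pscale c g) = c * pairing f g"
  by (simp add: pairing_def sum_distrib_left mult_ac)

lemma pairing_scale_left [simp]: "pairing (pscale c f) g = c * pairing f g"
  by (metis pairing_commute pairing_scale_right)

lemma pairing_diff_right: "pairing h (f - g) = pairing h f - pairing h g"
  using pairing_add_right[of h "f - g" g] by simp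

lemma pairing_diff_left: "pairing (f - g) h = pairing f h - pairing g h"
  using pairing_add_left[of "f - g" g h] by simp

lemma pairing_zero [simp]: "pairing 0 f = 0" "pairing f 0 = 0"
  by (simp_all add: pairing_def)

lemma pairing_sum_left: "pairing (sum f K) h = (\<Sum>k\<in>K. pairing (f k) h)"
  by (induction K rule: infinite_finite_induct) (simp_all add: pairing_add_left)

lemma pairing_single:
  "pairing (Poly_Mapping.single m a) (Poly_Mapping.single n b) = (if m = n then a * b * exponent_fact m else 0)"
  by (simp add: pairing_def lookup_single when_def)

lemma pairing_self_eq_0: "pairing f f = 0 \<Longrightarrow> f = 0"
proof -
  assume "pairing f f = 0"
  then have "\<forall>m\<in>Poly_Mapping.keys f. Poly_Mapping.lookup f m * (Poly_Mapping.lookup f m * exponent_fact m) = 0"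
    unfolding pairing_def
    by (subst (asm) sum_nonneg_eq_0_iff) (auto simp: mult.assoc[symmetric] exponent_fact_pos less_imp_le)
  moreover have "exponent_fact m \<noteq> 0" for m :: "'a \<Rightarrow>\<^sub>0 nat" using exponent_fact_pos[of m] by simp
  ultimately show "f = 0" by (metis in_keys_iff keys_eq_empty all_not_in_conv mult_eq_0_iff)
qed

lemma pairing_hcomponent: "pairing (hcomponent d f) g = pairing f (hcomponent d g)"
proof -
  have "pairing (hcomponent d f) g = (\<Sum>m\<in>Poly_Mapping.keys f.
     Poly_Mapping.lookup (hcomponent d f) m * (Poly_Mapping.lookup g m * exponent_fact m))"
    unfolding pairing_def by (rule sum_keys_superset) (auto simp: in_keys_iff split: if_splits)
  then show ?thesis
    unfolding pairing_def by (simp add: if_distrib cong: sum.cong) (rule sum.cong; auto)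
qed

lemma pairing_homogeneous: "homogeneous d f \<Longrightarrow> pairing f g = pairing f (hcomponent d g)"
  by (metis hcomponent_homogeneous pairing_hcomponent)

lemma pairing_homogeneous_neq:
  "homogeneous d f \<Longrightarrow> homogeneous e g \<Longrightarrow> d \<noteq> e \<Longrightarrow> pairing f g = 0"
  by (simp add: pairing_homogeneous hcomponent_homogeneous)

lemma pairing_degree_less: "homogeneous d f \<Longrightarrow> degree_less d g \<Longrightarrow> pairing f g = 0"
  unfolding pairing_def homogeneous_def degree_less_def by (intro sum.neutral) auto

text \<open>
  The Gram--Schmidt step divides by \<open>pairing b b\<close>, which positivity of the form allows over the
  rationals: no square roots occur since nothing is normalised.
\<close>

lemma orthogonal_projection:
  assumes "finite B"
  shows "\<exists>u\<in>rat_span B. \<forall>b\<in>rat_span B. pairing (f - u) b = 0"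
  using assms unfolding rat_span_def
proof (induction B arbitrary: f rule: finite_induct)
  case empty
  then show ?case by simp
next
  case (insert b B)
  obtain v where v: "v \<in> Q.span B" "\<And>c. c \<in> Q.span B \<Longrightarrow> pairing (b - v) c = 0"
    using insert.IH by blast
  obtain w where w: "w \<in> Q.span B" "\<And>c. c \<in> Q.span B \<Longrightarrow> pairing (f - w) c = 0"
    using insert.IH by blast
  let ?b = "b - v"
  define t where "t = (if ?b = 0 then 0 else pairing (f - w) ?b / pairing ?b ?b)"
  let ?u = "w + pscale t ?b"
  have bv: "?b \<in> Q.span (insert b B)"
    using v(1) Q.span_mono[of B "insert b B"] by (intro Q.span_diff) (auto intro: Q.span_base)
  have "?u \<in> Q.span (insert b B)"
    using bv w(1) Q.span_mono[of B "insert b B"] by (intro Q.span_add Q.span_scale) auto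
  moreover have "pairing (f - ?u) c = 0" if c: "c \<in> Q.span (insert b B)" for c
  proof -
    obtain k where k: "c - pscale k b \<in> Q.span B" using c Q.span_breakdown_eq by blast
    define c' where "c' = c - pscale k ?b"
    have "c' = (c - pscale k b) + pscale k v" by (simp add: c'_def Q.scale_right_diff_distrib)
    then have c': "c' \<in> Q.span B" using k v(1) by (simp add: Q.span_add Q.span_scale)
    have u: "f - ?u = (f - w) - pscale t ?b" by simp
    have ort: "pairing (f - ?u) ?b = 0"
    proof (cases "?b = 0")
      case False
      then have "pairing ?b ?b \<noteq> 0" using pairing_self_eq_0 by blast
      then have "pairing (f - w) ?b - t * pairing ?b ?b = 0" using False by (simp add: t_def)
      then show ?thesis unfolding u by (simp only: pairing_diff_left[of "f - w"] pairing_scale_left)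
    qed (simp only: pairing_zero)
    from u have "pairing (f - ?u) c' = 0" using v(2)[OF c'] w(2)[OF c']
      by (simp only: pairing_diff_left[of "f - w"] pairing_scale_left)
    moreover have "c = c' + pscale k ?b" by (simp add: c'_def)
    ultimately show ?thesis using ort by (simp only: pairing_add_right pairing_scale_right)
  qed
  ultimately show ?case by blast
qed

text \<open>
  This is applied to the part of an ideal in one degree, for which no finite spanning set is given
  explicitly.
\<close>

lemma orthogonal_projection_subspace:
  assumes "Q.subspace U" "finite B" "U \<subseteq> rat_span B"
  obtains u where "u \<in> U" "\<And>w. w \<in> U \<Longrightarrow> pairing (f - u) w = 0"
proof -
  obtain C where C: "C \<subseteq> U" "Q.independent C" "U \<subseteq> Q.span C"
    using Q.maximal_independent_subset by blast
  have "C \<subseteq> Q.span B" using C(1) assms(3) by (auto simp: rat_span_def)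
  then have "finite C" using Q.independent_span_bound[OF assms(2) C(2)] by blast
  moreover have "Q.span C = U" using C assms(1) by (metis Q.span_subspace)
  ultimately show ?thesis using orthogonal_projection[of C f] that by (auto simp: rat_span_def)
qed

lemma finite_exponents: "finite {m :: 'n::finite \<Rightarrow>\<^sub>0 nat. mdeg m = d}"
proof -
  have "Poly_Mapping.lookup ` {m :: 'n \<Rightarrow>\<^sub>0 nat. mdeg m = d} \<subseteq> (PiE UNIV (\<lambda>_. {..d}))"
    using member_le_sum[of _ "UNIV :: 'n set"] by (fastforce simp: mdeg_def PiE_def)
  moreover have "finite (PiE (UNIV :: 'n set) (\<lambda>_. {..d}))" by (rule finite_PiE) auto
  ultimately have "finite (Poly_Mapping.lookup ` {m :: 'n \<Rightarrow>\<^sub>0 nat. mdeg m = d})" by (rule finite_subset)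
  then show ?thesis by (rule finite_imageD) (auto simp: inj_on_def intro: poly_mapping_eqI)
qed

lemma homogeneous_in_monomial_span:
  "homogeneous d f \<Longrightarrow> f \<in> rat_span ((\<lambda>m. Poly_Mapping.single m 1) ` {m. mdeg m = d})"
  unfolding rat_span_def
proof -
  assume "homogeneous d f"
  then have "(\<Sum>m\<in>Poly_Mapping.keys f. pscale (Poly_Mapping.lookup f m) (Poly_Mapping.single m 1))
      \<in> Q.span ((\<lambda>m. Poly_Mapping.single m 1) ` {m. mdeg m = d})"
    by (intro Q.span_sum Q.span_scale Q.span_base) (auto simp: homogeneous_def)
  then show "f \<in> Q.span ((\<lambda>m. Poly_Mapping.single m 1) ` {m. mdeg m = d})"
    by (simp add: pscale_def PConst_mult_single rpoly_sum_single)
qed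

section \<open>Partial and directional derivatives\<close>

definition partial :: "'n \<Rightarrow> 'n::finite rpoly \<Rightarrow> 'n rpoly" where
  "partial i f = (\<Sum>m\<in>Poly_Mapping.keys f.
     Poly_Mapping.single (m - Poly_Mapping.single i 1) (of_nat (Poly_Mapping.lookup m i) * Poly_Mapping.lookup f m))"

lemma partial_add: "partial i (f + g) = partial i f + partial i g"
  unfolding partial_def by (rule sum_keys_add) (simp_all add: distrib_left single_add)

lemma partial_single:
  "partial i (Poly_Mapping.single m c) =
    Poly_Mapping.single (m - Poly_Mapping.single i 1) (of_nat (Poly_Mapping.lookup m i) * c)"
  by (simp add: partial_def)

lemma partial_PConst [simp]: "partial i (PConst c) = 0"
  by (simp add: PConst_def partial_single)

text \<open>
  Together with additivity and vanishing on constants, this rule determines \<open>\<partial>\<^sub>i\<close>; the Leibniz rule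
  follows from it by induction.
\<close>

lemma partial_PVar_mult:
  "partial i (PVar j * f) = (if i = j then f else 0) + PVar j * partial i f"
proof (induction f rule: poly_mapping_additive_induct)
  case (single m c)
  show ?case
  proof (cases "Poly_Mapping.lookup m i = 0")
    case True
    then show ?thesis by (auto simp: PVar_mult_single partial_single lookup_add lookup_single when_def)
  next
    case False
    then have m: "Poly_Mapping.single i 1 + (m - Poly_Mapping.single i 1) = m"
      using exponent_split[of m i] by simp
    have *: "Poly_Mapping.single j 1 + m - Poly_Mapping.single i 1 = Poly_Mapping.single j 1 + (m - Poly_Mapping.single i 1)"
      using add_diff_cancel_left'[of "Poly_Mapping.single i 1"
          "Poly_Mapping.single j 1 + (m - Poly_Mapping.single i 1)"]
      by (simp only: add.left_commute[of "Poly_Mapping.single i 1"] m)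
    show ?thesis
      using m * by (auto simp: PVar_mult_single partial_single lookup_add lookup_single when_def
          single_add[symmetric] distrib_right)
  qed
qed (simp add: partial_add distrib_left)

lemma partial_Leibniz: "partial i (f * g) = partial i f * g + f * partial i g"
proof (induction f rule: rpoly_induct)
  case (const c)
  have "partial i (PConst c * g) = PConst c * partial i g" for g :: "'a rpoly"
    by (induction g rule: poly_mapping_additive_induct)
      (simp_all add: partial_add distrib_left PConst_mult_single partial_single mult_ac)
  then show ?case by simp
next
  case (var j f)
  then show ?case by (simp only: mult.assoc partial_PVar_mult distrib_left distrib_right) simp
qed (simp add: partial_add algebra_simps)

text \<open>
  Multiplication by \<open>x\<^sub>i\<close> is adjoint to \<open>\<partial>\<^sub>i\<close>: on monomials this is \<open>n! = n\<^sub>i (n - e\<^sub>i)!\<close>.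
\<close>

lemma pairing_PVar_mult: "pairing (PVar i * f) g = pairing f (partial i g)"
proof (induction f rule: poly_mapping_additive_induct)
  case (single m c)
  show ?case
  proof (induction g rule: poly_mapping_additive_induct)
    case (single n d)
    show ?case
    proof (cases "Poly_Mapping.lookup n i = 0")
      case True
      then have "Poly_Mapping.single i 1 + m \<noteq> n" by (auto simp: lookup_add)
      then show ?thesis using True by (simp add: PVar_mult_single partial_single pairing_single)
    next
      case False
      define n' where "n' = n - Poly_Mapping.single i 1"
      have n: "n = Poly_Mapping.single i 1 + n'"
        using False exponent_split[of n i] by (simp add: n'_def)
      have "exponent_fact n = of_nat (Poly_Mapping.lookup n i) * exponent_fact n'"
      proof -
        have "exponent_fact n = fact (Poly_Mapping.lookup n i) * (\<Prod>k\<in>UNIV - {i}. fact (Poly_Mapping.lookup n k))"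
          unfolding exponent_fact_def by (rule prod.remove) auto
        also have "(\<Prod>k\<in>UNIV - {i}. fact (Poly_Mapping.lookup n k)) = (\<Prod>k\<in>UNIV - {i}. fact (Poly_Mapping.lookup n' k) :: rat)"
          by (intro prod.cong) (auto simp: n lookup_add lookup_single when_def)
        also have "fact (Poly_Mapping.lookup n i) = (of_nat (Poly_Mapping.lookup n i) * fact (Poly_Mapping.lookup n' i) :: rat)"
          by (simp add: n lookup_add)
        also have "of_nat (Poly_Mapping.lookup n i) * fact (Poly_Mapping.lookup n' i) * (\<Prod>k\<in>UNIV - {i}. fact (Poly_Mapping.lookup n' k))
           = of_nat (Poly_Mapping.lookup n i) * (exponent_fact n' :: rat)"
          unfolding exponent_fact_def mult.assoc by (subst prod.remove[of UNIV i]) auto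
        finally show ?thesis .
      qed
      moreover have "Poly_Mapping.single i 1 + m = n \<longleftrightarrow> m = n'" by (simp add: n)
      moreover have "partial i (Poly_Mapping.single n d) =
          Poly_Mapping.single n' (of_nat (Poly_Mapping.lookup n i) * d)"
        by (simp only: partial_single n'_def)
      moreover have "Poly_Mapping.single i (Suc 0) + n' = n" using n by simp
      ultimately show ?thesis by (simp add: PVar_mult_single pairing_single mult_ac)
    qed
  qed (simp add: partial_add pairing_add_right)
qed (simp add: distrib_left pairing_add_left)

text \<open>
  The derivative in the direction of the indicator vector of \<open>S\<close>; it is adjoint to multiplication by
  \<open>x\<^sub>S\<close>.
\<close>

definition dirderiv :: "'n set \<Rightarrow> 'n::finite rpoly \<Rightarrow> 'n rpoly" where
  "dirderiv S f = (\<Sum>i\<in>S. partial i f)"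

lemma dirderiv_add: "dirderiv S (f + g) = dirderiv S f + dirderiv S g"
  by (simp add: dirderiv_def partial_add sum.distrib)

lemma dirderiv_Leibniz: "dirderiv S (f * g) = dirderiv S f * g + f * dirderiv S g"
  by (simp add: dirderiv_def partial_Leibniz sum.distrib sum_distrib_left sum_distrib_right)

lemma dirderiv_PConst [simp]: "dirderiv S (PConst c) = 0"
  by (simp add: dirderiv_def)

lemma dirderiv_0 [simp]: "dirderiv S 0 = 0"
  using dirderiv_PConst[of S 0] by simp

lemma dirderiv_PVar [simp]: "dirderiv S (PVar i) = (if i \<in> S then 1 else 0)"
proof -
  have "partial j (PVar i) = (if j = i then 1 else 0)" for j
    using partial_PVar_mult[of j i 1] partial_PConst[of j 1] by (simp add: PConst_1)
  then show ?thesis by (simp add: dirderiv_def)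
qed

lemma pairing_xsum_mult: "pairing (xsum S * f) g = pairing f (dirderiv S g)"
proof -
  have "pairing f (sum h S) = (\<Sum>k\<in>S. pairing f (h k))" for h
    using pairing_sum_left[of h S f] by (simp add: pairing_commute)
  then show ?thesis
    by (simp add: xsum_def sum_distrib_right pairing_sum_left pairing_PVar_mult dirderiv_def)
qed

lemma pairing_xsum_power_mult: "pairing (xsum S ^ k * f) g = pairing f ((dirderiv S ^^ k) g)"
proof (induction k arbitrary: g)
  case (Suc k)
  have "pairing (xsum S ^ Suc k * f) g = pairing (xsum S ^ k * f) (dirderiv S g)"
    by (simp add: mult.assoc pairing_xsum_mult)
  also have "\<dots> = pairing f ((dirderiv S ^^ Suc k) g)" by (simp only: Suc funpow_Suc_right comp_apply)
  finally show ?case .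
qed simp

lemma dirderiv_uminus: "dirderiv S (- f) = - dirderiv S f"
  using dirderiv_add[of S f "- f"] by (simp add: eq_neg_iff_add_eq_0 add.commute)

lemma dirderiv_diff: "dirderiv S (f - g) = dirderiv S f - dirderiv S g"
  using dirderiv_add[of S f "- g"] by (simp add: dirderiv_uminus)

lemma dirderiv_pscale: "dirderiv S (pscale c f) = pscale c (dirderiv S f)"
  by (simp add: pscale_def dirderiv_Leibniz)

lemma dirderiv_power_linear:
  "(dirderiv S ^^ k) 0 = 0"
  "(dirderiv S ^^ k) (f + g) = (dirderiv S ^^ k) f + (dirderiv S ^^ k) g"
  "(dirderiv S ^^ k) (f - g) = (dirderiv S ^^ k) f - (dirderiv S ^^ k) g"
  "(dirderiv S ^^ k) (pscale c f) = pscale c ((dirderiv S ^^ k) f)"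
  by (induction k) (simp_all add: dirderiv_add dirderiv_diff dirderiv_pscale)

lemma dirderiv_power_mono: "(dirderiv S ^^ k) f = 0 \<Longrightarrow> k \<le> l \<Longrightarrow> (dirderiv S ^^ l) f = 0"
  by (metis dirderiv_power_linear(1) funpow_add comp_apply le_add_diff_inverse2)

text \<open>
  The higher derivatives of a linear form vanish, so the Leibniz expansion has only two terms.
\<close>

lemma dirderiv_power_linear_form:
  assumes "dirderiv S l = PConst c"
  shows "(dirderiv S ^^ Suc k) (l * h) =
    l * (dirderiv S ^^ Suc k) h + pscale (of_nat (Suc k) * c) ((dirderiv S ^^ k) h)"
proof (induction k)
  case 0
  then show ?case by (simp add: dirderiv_Leibniz assms pscale_def)
next
  case (Suc k)
  have "(dirderiv S ^^ Suc (Suc k)) (l * h) = dirderiv S ((dirderiv S ^^ Suc k) (l * h))" by simp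
  also have "\<dots> = l * (dirderiv S ^^ Suc (Suc k)) h + PConst c * (dirderiv S ^^ Suc k) h
      + pscale (of_nat (Suc k) * c) ((dirderiv S ^^ Suc k) h)"
    unfolding Suc by (simp add: dirderiv_add dirderiv_Leibniz assms dirderiv_pscale)
  also have "PConst c * (dirderiv S ^^ Suc k) h = pscale c ((dirderiv S ^^ Suc k) h)" by (simp add: pscale_def)
  finally show ?case
    unfolding of_nat_Suc[of "Suc k"] distrib_right mult_1 Q.scale_left_distrib by (simp only: add.assoc)
qed

lemma dirderiv_nilpotent: "\<exists>k. (dirderiv S ^^ k) f = 0"
proof (induction f rule: rpoly_induct)
  case (const c)
  show ?case by (rule exI[of _ 1]) simp
next
  case (add f g)
  then obtain k l where "(dirderiv S ^^ k) f = 0" "(dirderiv S ^^ l) g = 0" by blast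
  then have "(dirderiv S ^^ max k l) (f + g) = 0"
    using dirderiv_power_mono[of k S f "max k l"] dirderiv_power_mono[of l S g "max k l"]
    by (simp add: dirderiv_power_linear)
  then show ?case ..
next
  case (var i f)
  then obtain k where k: "(dirderiv S ^^ k) f = 0" by blast
  have "dirderiv S (PVar i) = PConst (if i \<in> S then 1 else 0)" by (simp add: PConst_1)
  from dirderiv_power_linear_form[OF this, of k f] k have "(dirderiv S ^^ Suc k) (PVar i * f) = 0" by simp
  then show ?case ..
qed

text \<open>
  A factor that is not constant in the direction \<open>S\<close> raises the degree in that direction by exactly
  one. If \<open>h\<close> is first annihilated by the power \<open>M + 1\<close> of the derivative, then the two-term expansion
  of the power \<open>M + 1\<close> at \<open>l * h\<close> leaves a nonzero multiple of the nonzero \<open>M\<close>-th derivative of \<open>h\<close>.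
  For \<open>k = 0\<close> this says that \<open>l * h\<close> can be constant in the direction \<open>S\<close> only if \<open>h = 0\<close>.
\<close>

lemma dirderiv_cancel_linear_form:
  assumes l: "dirderiv S l = PConst c" "c \<noteq> 0" and z: "(dirderiv S ^^ Suc k) (l * h) = 0"
  shows "(dirderiv S ^^ k) h = 0"
proof (rule ccontr)
  assume nz: "(dirderiv S ^^ k) h \<noteq> 0"
  define N where "N = (LEAST N. (dirderiv S ^^ N) h = 0)"
  have N: "(dirderiv S ^^ N) h = 0" unfolding N_def using dirderiv_nilpotent by (rule LeastI_ex)
  have "k < N" using nz dirderiv_power_mono[OF N] not_less by blast
  then obtain M where M: "N = Suc M" "k \<le> M" by (metis Suc_le_D Suc_le_eq Suc_le_mono)
  have "(dirderiv S ^^ Suc M) (l * h) = 0" using dirderiv_power_mono[OF z, of "Suc M"] M(2) by simp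
  then have "pscale (of_nat (Suc M) * c) ((dirderiv S ^^ M) h) = 0"
    using dirderiv_power_linear_form[OF l(1), of M h] N M(1) by simp
  then have "(dirderiv S ^^ M) h = 0" using l(2) by (metis Q.scale_eq_0_iff mult_eq_0_iff of_nat_neq_0)
  then have "N \<le> M" unfolding N_def by (rule Least_le)
  then show False using M(1) by simp
qed

lemma dirderiv_power_mult_const:
  assumes "dirderiv S l = 0"
  shows "(dirderiv S ^^ k) (l * h) = l * (dirderiv S ^^ k) h"
  by (induction k) (simp_all add: dirderiv_Leibniz assms)

text \<open>
  The chain rule for a substitution of variables by variables, which need not be injective: it will be
  applied to the identification of two endpoints.
\<close>

lemma dirderiv_permute_vars: "dirderiv S (permute_vars r f) = permute_vars r (dirderiv (r -` S) f)"
  by (induction f rule: rpoly_induct) (simp_all add: dirderiv_add dirderiv_Leibniz)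

lemma dirderiv_power_permute_vars:
  "(dirderiv S ^^ k) (permute_vars r f) = permute_vars r ((dirderiv (r -` S) ^^ k) f)"
  by (induction k) (simp_all add: dirderiv_permute_vars)

text \<open>
  Every monomial other than 1 is a multiple of a variable, and is therefore orthogonal to a polynomial
  whose partial derivatives vanish.
\<close>

lemma partial_all_zero_imp_const:
  assumes "\<And>i. partial i f = 0"
  shows "f = PConst (Poly_Mapping.lookup f 0)"
proof -
  have "pairing (Poly_Mapping.single m 1) f = 0" if "m \<noteq> 0" for m
  proof -
    obtain i where "Poly_Mapping.lookup m i > 0"
      using exponent_nonzero_ex[OF \<open>m \<noteq> 0\<close>] by blast
    then have "Poly_Mapping.single m 1 = PVar i * Poly_Mapping.single (m - Poly_Mapping.single i 1) 1"
      using exponent_split[of m i] by (simp add: PVar_mult_single)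
    then show ?thesis by (simp add: pairing_PVar_mult assms)
  qed
  moreover have "exponent_fact m \<noteq> 0" for m :: "'a \<Rightarrow>\<^sub>0 nat" using exponent_fact_pos[of m] by simp
  ultimately have "Poly_Mapping.lookup f m = 0" if "m \<noteq> 0" for m
    using that by (simp add: pairing_def)
  then show ?thesis
    by (intro poly_mapping_eqI) (auto simp: PConst_def lookup_single when_def)
qed

section \<open>Difference operators\<close>

text \<open>
  The polynomial \<open>f(x + e\<^sub>i)\<close>.
\<close>

definition shift :: "'n \<Rightarrow> 'n::finite rpoly \<Rightarrow> 'n rpoly" where
  "shift i = subst.insertion (\<lambda>k. PVar k + (if k = i then 1 else 0))"

lemma shift_simps [simp]:
  "shift i (f + g) = shift i f + shift i g"
  "shift i (PConst c) = PConst c"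
  "shift i (PVar k * f) = (PVar k + (if k = i then 1 else 0)) * shift i f"
  by (simp_all add: shift_def subst.insertion_add subst.insertion_mult subst.insertion_PConst subst.insertion_PVar)

lemma poly_eval_shift: "poly_eval a (shift i f) = poly_eval (\<lambda>k. a k + (if k = i then 1 else 0)) f"
  by (induction f rule: rpoly_induct) simp_all

lemma partial_degree_less: "degree_less (Suc k) f \<Longrightarrow> degree_less k (partial i f)"
  unfolding partial_def
proof (rule degree_less_sum)
  fix m assume f: "degree_less (Suc k) f" and m: "m \<in> Poly_Mapping.keys f"
  show "degree_less k (Poly_Mapping.single (m - Poly_Mapping.single i 1)
      (of_nat (Poly_Mapping.lookup m i) * Poly_Mapping.lookup f m))"
  proof (cases "Poly_Mapping.lookup m i = 0")
    case False
    then have "mdeg m = Suc (mdeg (m - Poly_Mapping.single i 1))"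
      by (metis exponent_split mdeg_add mdeg_single neq0_conv plus_1_eq_Suc)
    then have "mdeg (m - Poly_Mapping.single i 1) < k" using f m by (auto simp: degree_less_keys)
    then show ?thesis by (simp add: degree_less_keys)
  qed (simp add: degree_less_linear)
qed

text \<open>
  First-order Taylor expansion: the remainder loses two degrees. It is checked on monomials by
  splitting off one variable at a time.
\<close>

lemma shift_Taylor:
  assumes "degree_less (Suc k) f"
  shows "degree_less (k - 1) (shift i f - f - partial i f)"
proof -
  have mono: "degree_less (mdeg m - 1) (shift i (Poly_Mapping.single m c) - Poly_Mapping.single m c - partial i (Poly_Mapping.single m c))"
    for m c
  proof (induction "mdeg m" arbitrary: m)
    case 0
    then have "m = 0" by simp
    then show ?case using shift_simps(2)[of i c] partial_PConst[of i c] by (simp add: PConst_def)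
  next
    case (Suc d)
    then have "m \<noteq> 0" by auto
    then obtain j where j: "Poly_Mapping.lookup m j > 0"
      using exponent_nonzero_ex by blast
    define n where "n = m - Poly_Mapping.single j 1"
    have m: "m = Poly_Mapping.single j 1 + n" unfolding n_def by (rule exponent_split[OF j])
    then have d: "mdeg n = d" using Suc(2) by simp
    let ?u = "Poly_Mapping.single n c"
    let ?D = "shift i ?u - ?u - partial i ?u"
    have IH: "degree_less (d - 1) ?D" using Suc(1)[of n] d by simp
    have u: "Poly_Mapping.single m c = PVar j * ?u" by (simp add: m PVar_mult_single)
    have x: "degree_less (Suc 1) (PVar j)" by (rule degree_less_homogeneous[OF homogeneous_PVar]) simp
    have "degree_less d (PVar j * ?D)"
      using degree_less_mult[OF x IH] IH by (cases d) auto
    moreover have "degree_less d (?D + partial i ?u)"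
    proof (rule degree_less_linear)
      show "degree_less d ?D" by (rule degree_less_mono[OF IH]) simp
      show "degree_less d (partial i ?u)"
        by (rule partial_degree_less) (simp add: degree_less_keys d)
    qed
    ultimately have "degree_less d (PVar j * ?D + (if j = i then ?D + partial i ?u else 0))"
      by (simp add: degree_less_linear)
    also have "PVar j * ?D + (if j = i then ?D + partial i ?u else 0)
       = shift i (PVar j * ?u) - PVar j * ?u - partial i (PVar j * ?u)"
      by (auto simp: partial_PVar_mult algebra_simps)
    finally show ?case using Suc(2)[symmetric] by (simp add: u)
  qed
  have "degree_less (k - 1) (shift i f' - f' - partial i f')"
    if "f' = (\<Sum>m\<in>K. Poly_Mapping.single m (Poly_Mapping.lookup f m))" "finite K" "K \<subseteq> Poly_Mapping.keys f" for K f'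
    using that(2,3) unfolding that(1)
  proof (induction K)
    case empty
    then show ?case using shift_simps(2)[of i 0] partial_PConst[of i 0] by (simp add: degree_less_linear)
  next
    case (insert m K)
    let ?u = "Poly_Mapping.single m (Poly_Mapping.lookup f m)" and ?v = "\<Sum>m\<in>K. Poly_Mapping.single m (Poly_Mapping.lookup f m)"
    have "mdeg m - 1 \<le> k - 1" using insert.prems assms by (fastforce simp: degree_less_keys)
    then have "degree_less (k - 1) (shift i ?u - ?u - partial i ?u)" using mono degree_less_mono by blast
    moreover have "degree_less (k - 1) (shift i ?v - ?v - partial i ?v)" using insert by simp
    ultimately have "degree_less (k - 1) ((shift i ?u - ?u - partial i ?u) + (shift i ?v - ?v - partial i ?v))"
      by (rule degree_less_linear)
    then show ?case using insert by (simp add: partial_add algebra_simps)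
  qed
  from this[OF refl finite_keys subset_refl] show ?thesis by (simp add: rpoly_sum_single)
qed

section \<open>The central P-space of an oriented multigraph\<close>

text \<open>
  Edges are oriented here, and loops are admitted, because contraction identifies vertices: the image
  of an ordered pair under the identification is again an ordered pair, the forms \<open>x\<^sub>a - x\<^sub>b\<close>
  transform without signs, and edges parallel to the contracted one become loops. The vertex type never
  changes; a contracted vertex stays behind as an isolated one.
\<close>

definition arc_cut :: "('n \<times> 'n) multiset \<Rightarrow> 'n set \<Rightarrow> ('n \<times> 'n) multiset" where
  "arc_cut A S = {#a \<in># A. (fst a \<in> S) \<noteq> (snd a \<in> S)#}"

definition arc_form :: "'n \<times> 'n \<Rightarrow> 'n::finite rpoly" where
  "arc_form a = PVar (fst a) - PVar (snd a)"

definition arc_poly :: "('n \<times> 'n) multiset \<Rightarrow> 'n::finite rpoly" where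
  "arc_poly Y = (\<Prod>a\<in>#Y. arc_form a)"

text \<open>
  For a connected graph this is slimness. Phrased by cuts, it makes sense for disconnected graphs, which
  appear after contraction, and it is easily compared along deletion and contraction.
\<close>

definition cut_free :: "('n \<times> 'n) multiset \<Rightarrow> ('n \<times> 'n) multiset \<Rightarrow> bool" where
  "cut_free A Y \<longleftrightarrow> Y \<subseteq># A \<and> (\<forall>S. arc_cut A S \<noteq> {#} \<longrightarrow> \<not> arc_cut A S \<subseteq># Y)"

definition arc_space :: "('n::finite \<times> 'n) multiset \<Rightarrow> 'n rpoly set" where
  "arc_space A = rat_span {arc_poly Y | Y. cut_free A Y}"

text \<open>
  The exponent is at least 1 so that unions of components, which have an empty cut, contribute the
  condition \<open>dirderiv S f = 0\<close>, as \<open>xsum UNIV\<close> does in the power ideal.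
\<close>

definition cut_annihilated :: "('n::finite \<times> 'n) multiset \<Rightarrow> 'n rpoly \<Rightarrow> bool" where
  "cut_annihilated A f \<longleftrightarrow> (\<forall>S. (dirderiv S ^^ max 1 (size (arc_cut A S))) f = 0)"

lemma arc_cut_add_mset:
  "arc_cut (add_mset a A) S = (if (fst a \<in> S) \<noteq> (snd a \<in> S) then add_mset a (arc_cut A S) else arc_cut A S)"
  by (simp add: arc_cut_def)

lemma arc_cut_subset: "arc_cut A S \<subseteq># A"
  by (simp add: arc_cut_def)

lemma arc_cut_mono: "A \<subseteq># B \<Longrightarrow> arc_cut A S \<subseteq># arc_cut B S"
  unfolding arc_cut_def by (rule multiset_filter_mono)

lemma arc_poly_add_mset: "arc_poly (add_mset a Y) = arc_form a * arc_poly Y"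
  by (simp add: arc_poly_def)

lemma dirderiv_arc_form:
  "dirderiv S (arc_form a) = PConst ((if fst a \<in> S then 1 else 0) - (if snd a \<in> S then 1 else 0))"
  by (simp add: arc_form_def dirderiv_diff PConst_1 PConst_uminus)

text \<open>
  Only the factors whose edge crosses the cut depend on the direction \<open>S\<close>.
\<close>

lemma dirderiv_power_arc_poly:
  "size (arc_cut Y S) < k \<Longrightarrow> (dirderiv S ^^ k) (arc_poly Y) = 0"
proof (induction Y arbitrary: k)
  case empty
  then have "k \<noteq> 0" by simp
  then obtain k' where "k = Suc k'" by (auto simp: gr0_conv_Suc)
  moreover have "(dirderiv S ^^ Suc 0) (arc_poly {#}) = 0"
    using dirderiv_PConst[of S 1] by (simp add: arc_poly_def PConst_1)
  ultimately show ?case by (metis dirderiv_power_mono le_numeral_extra(3) Suc_le_mono le0)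
next
  case (add a Y)
  show ?case
  proof (cases "(fst a \<in> S) \<noteq> (snd a \<in> S)")
    case True
    then obtain k' where k': "k = Suc k'" "size (arc_cut Y S) < k'"
      using add.prems by (cases k) (auto simp: arc_cut_add_mset)
    show ?thesis
      unfolding arc_poly_add_mset k'(1) dirderiv_power_linear_form[OF dirderiv_arc_form]
      using add.IH[of k'] add.IH[of "Suc k'"] k'(2) by (simp del: funpow.simps)
  next
    case False
    then have "dirderiv S (arc_form a) = 0" by (auto simp: dirderiv_arc_form)
    then show ?thesis
      using add.IH[of k] add.prems False
      by (auto simp: arc_poly_add_mset dirderiv_power_mult_const arc_cut_add_mset split: if_splits)
  qed
qed

lemma cut_annihilated_linear:
  "cut_annihilated A 0"
  "cut_annihilated A f \<Longrightarrow> cut_annihilated A g \<Longrightarrow> cut_annihilated A (f + g)"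
  "cut_annihilated A f \<Longrightarrow> cut_annihilated A g \<Longrightarrow> cut_annihilated A (f - g)"
  "cut_annihilated A f \<Longrightarrow> cut_annihilated A (pscale c f)"
  by (simp_all add: cut_annihilated_def dirderiv_power_linear)

lemma arc_space_annihilated:
  assumes "p \<in> arc_space A"
  shows "cut_annihilated A p"
  using assms unfolding arc_space_def rat_span_def
proof (induction rule: Q.span_induct_alt)
  case (step c x y)
  then obtain Y where Y: "x = arc_poly Y" "cut_free A Y" by blast
  have "size (arc_cut Y S) < max 1 (size (arc_cut A S))" for S
  proof (cases "arc_cut A S = {#}")
    case True
    then show ?thesis using arc_cut_mono[of Y A S] Y(2) by (simp add: cut_free_def)
  next
    case False
    then have "arc_cut Y S \<noteq> arc_cut A S"
      using Y(2) arc_cut_subset[of Y S] by (auto simp: cut_free_def)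
    then have "arc_cut Y S \<subset># arc_cut A S"
      using arc_cut_mono[of Y A S] Y(2) by (auto simp: cut_free_def subset_mset_def)
    then show ?thesis using mset_subset_size[of "arc_cut Y S" "arc_cut A S"] by simp
  qed
  then have "cut_annihilated A x" using Y(1) by (simp add: cut_annihilated_def dirderiv_power_arc_poly)
  then show ?case using step by (simp add: cut_annihilated_linear)
qed (rule cut_annihilated_linear)

lemma cut_annihilated_loop:
  "cut_annihilated (add_mset (i, i) A) f \<longleftrightarrow> cut_annihilated A f"
  by (simp add: cut_annihilated_def arc_cut_add_mset)

lemma cut_free_loop: "cut_free A Y \<Longrightarrow> cut_free (add_mset (i, i) A) Y"
  by (auto simp: cut_free_def arc_cut_add_mset intro: subset_mset.order_trans)

lemma arc_cut_image:
  "arc_cut (image_mset (map_prod r r) A) S = image_mset (map_prod r r) (arc_cut A (r -` S))"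
  by (simp add: arc_cut_def filter_mset_image_mset)

text \<open>
  Cuts of the contraction are the cuts of the original graph that do not separate \<open>i\<close> from \<open>j\<close>. A cut
  that does separate them contains one copy of \<open>(i, j)\<close> more than \<open>Y\<close>, which is taken from \<open>A\<close>, can.
\<close>

lemma cut_free_contract:
  assumes r: "r = (\<lambda>k. if k = i then j else k)"
    and Z: "cut_free (image_mset (map_prod r r) A) Z"
  obtains Y where "cut_free (add_mset (i, j) A) Y" "arc_poly Z = permute_vars r (arc_poly Y)"
proof -
  have "Z \<subseteq># image_mset (map_prod r r) A" using Z by (simp add: cut_free_def)
  then obtain W where "image_mset (map_prod r r) A = Z + W" by (metis subset_mset.le_iff_add)
  then obtain Y Y' where Y: "A = Y + Y'" "Z = image_mset (map_prod r r) Y"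
    using image_mset_eq_plusD by blast
  have "\<not> arc_cut (add_mset (i, j) A) S \<subseteq># Y" if ne: "arc_cut (add_mset (i, j) A) S \<noteq> {#}" for S
  proof (cases "(i \<in> S) = (j \<in> S)")
    case True
    then have S: "r -` S = S" by (auto simp: r split: if_splits)
    have c: "arc_cut (add_mset (i, j) A) S = arc_cut A S" using True by (simp add: arc_cut_add_mset)
    then have "arc_cut (image_mset (map_prod r r) A) S \<noteq> {#}" using ne by (simp add: arc_cut_image S)
    then have "\<not> arc_cut (image_mset (map_prod r r) A) S \<subseteq># Z"
      using Z unfolding cut_free_def by blast
    then have "\<not> image_mset (map_prod r r) (arc_cut A S) \<subseteq># Z" by (simp add: arc_cut_image S)
    then show ?thesis unfolding c Y(2) using image_mset_subseteq_mono by blast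
  next
    case False
    then have "count (arc_cut (add_mset (i, j) A) S) (i, j) = Suc (count A (i, j))"
      by (simp add: arc_cut_def)
    then show ?thesis using mset_subset_eq_count[of "arc_cut (add_mset (i, j) A) S" Y "(i, j)"] Y(1) by auto
  qed
  moreover have "Y \<subseteq># add_mset (i, j) A" unfolding Y(1) by simp
  moreover have "arc_poly Z = permute_vars r (arc_poly Y)"
    unfolding Y(2) by (induction Y) (simp_all add: arc_poly_def arc_form_def)
  ultimately show ?thesis by (intro that[of Y]) (simp_all add: cut_free_def)
qed

text \<open>
  Deletion and contraction of an edge \<open>(i, j)\<close>. Restriction to \<open>x\<^sub>i = x\<^sub>j\<close> maps \<open>arc_space A\<close> onto the
  space of the contraction; the kernel is \<open>x\<^sub>i - x\<^sub>j\<close> times the space of the deletion, unless the edge is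
  a bridge, when the kernel is zero. The induction transports \<open>f\<close> along these two maps. If some cut
  consists of \<open>(i, j)\<close> alone, the hypothesis for that cut forces the cofactor to vanish.
\<close>

theorem cut_annihilated_imp_arc_space:
  "cut_annihilated A f \<Longrightarrow> f \<in> arc_space A"
proof (induction "size A" arbitrary: A f)
  case 0
  then have A: "A = {#}" by simp
  have "partial i f = 0" for i
    using 0(2)[unfolded cut_annihilated_def, rule_format, of "{i}"]
    by (simp add: A arc_cut_def dirderiv_def)
  then have "f = pscale (Poly_Mapping.lookup f 0) (arc_poly {#})"
    using partial_all_zero_imp_const[of f] by (simp add: arc_poly_def pscale_def)
  moreover have "cut_free A {#}" by (simp add: cut_free_def A arc_cut_def)
  ultimately show ?case unfolding arc_space_def rat_span_def by (metis (mono_tags, lifting) Q.span_base Q.span_scale mem_Collect_eq)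
next
  case (Suc n)
  obtain a A' where a: "A = add_mset a A'"
    using size_eq_Suc_imp_eq_union[of A n] Suc(2) by auto
  obtain i j where "a = (i, j)" by (rule prod.exhaust)
  with a Suc(2) have A: "A = add_mset (i, j) A'" and n: "size A' = n" by simp_all
  show ?case
  proof (cases "i = j")
    case True
    have "cut_annihilated A' f" using Suc(3) unfolding A True cut_annihilated_loop .
    then have "f \<in> arc_space A'" using Suc(1) n by simp
    moreover have "{arc_poly Y | Y. cut_free A' Y} \<subseteq> {arc_poly Y | Y. cut_free A Y}"
      unfolding A True using cut_free_loop by fast
    ultimately show ?thesis unfolding arc_space_def rat_span_def by (meson Q.span_mono subsetD)
  next
    case False
    define r where r: "r = (\<lambda>k. if k = i then j else k)"
    let ?l = "arc_form (i, j)"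
    have cut_pull: "arc_cut (image_mset (map_prod r r) A') S = image_mset (map_prod r r) (arc_cut A (r -` S))" for S
      by (auto simp: A arc_cut_add_mset r arc_cut_image split: if_splits)
    have "cut_annihilated (image_mset (map_prod r r) A') (permute_vars r f)"
      using Suc(3) by (simp add: cut_annihilated_def dirderiv_power_permute_vars cut_pull)
    then have "permute_vars r f \<in> arc_space (image_mset (map_prod r r) A')"
      using Suc(1)[of "image_mset (map_prod r r) A'"] n by simp
    \<comment> \<open>Lift the expression of the restriction, generator by generator, to the uncontracted graph.\<close>
    then have "\<exists>p\<in>arc_space A. permute_vars r f = permute_vars r p"
      unfolding arc_space_def rat_span_def
    proof (induction rule: Q.span_induct_alt)
      case base
      show ?case by (intro bexI[of _ 0]) (simp_all add: Q.span_zero)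
    next
      case (step c x y)
      then obtain p where p: "p \<in> Q.span {arc_poly Y |Y. cut_free A Y}" "y = permute_vars r p" by blast
      obtain Y where Y: "cut_free A Y" "x = permute_vars r (arc_poly Y)"
        using step(1) cut_free_contract[OF r] unfolding A by blast
      show ?case
      proof (rule bexI)
        show "pscale c x + y = permute_vars r (pscale c (arc_poly Y) + p)" using p(2) Y(2) by simp
        show "pscale c (arc_poly Y) + p \<in> Q.span {arc_poly Y |Y. cut_free A Y}"
          using Y(1) by (intro Q.span_add[OF Q.span_scale[OF Q.span_base] p(1)]) auto
      qed
    qed
    then obtain p where p: "p \<in> arc_space A" "permute_vars r f = permute_vars r p" by blast
    obtain h where h: "f - p = ?l * h"
      using identify_vars_cong[of "f - p" i j] p(2) by (auto simp: r arc_form_def)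
    have ann: "cut_annihilated A (?l * h)"
      using Suc(3) arc_space_annihilated[OF p(1)] by (simp add: h[symmetric] cut_annihilated_linear)
    \<comment> \<open>Where the cut loses the edge, one derivative less than for the product annihilates the cofactor.\<close>
    have crossing: "(dirderiv S ^^ size (arc_cut A' S)) h = 0" if "(i \<in> S) \<noteq> (j \<in> S)" for S
    proof (rule dirderiv_cancel_linear_form[OF dirderiv_arc_form])
      show "(dirderiv S ^^ Suc (size (arc_cut A' S))) (?l * h) = 0"
        using ann[unfolded cut_annihilated_def, rule_format, of S] that
        by (simp add: A arc_cut_add_mset del: funpow.simps)
    qed (use that in auto)
    have "?l * h \<in> arc_space A"
    proof (cases "\<exists>S. (i \<in> S) \<noteq> (j \<in> S) \<and> arc_cut A' S = {#}")
      case True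
      then have "h = 0" using crossing by force
      then show ?thesis by (simp add: arc_space_def rat_span_def Q.span_zero)
    next
      case no_bridge: False
      have "cut_annihilated A' h"
        unfolding cut_annihilated_def
      proof
        fix S
        show "(dirderiv S ^^ max 1 (size (arc_cut A' S))) h = 0"
        proof (cases "(i \<in> S) \<noteq> (j \<in> S)")
          case True
          then show ?thesis using crossing[of S] dirderiv_power_mono by (metis max.cobounded2)
        next
          case False
          let ?u = "(dirderiv S ^^ max 1 (size (arc_cut A' S))) h"
          have "dirderiv S ?l = 0" using False by (simp add: dirderiv_arc_form)
          then have "?l * ?u = 0"
            using ann[unfolded cut_annihilated_def, rule_format, of S] False
            by (simp add: A arc_cut_add_mset dirderiv_power_mult_const)
          \<comment> \<open>The linear form is not a zero divisor: derive in the direction of one of its variables.\<close>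
          moreover have "dirderiv {i} ?l = PConst 1" using \<open>i \<noteq> j\<close> by (simp add: dirderiv_arc_form)
          ultimately show ?thesis using dirderiv_cancel_linear_form[of "{i}" ?l 1 0 ?u] by simp
        qed
      qed
      then have "h \<in> arc_space A'" using Suc(1)[of A'] n by simp
      then show ?thesis
        unfolding arc_space_def rat_span_def
      proof (induction rule: Q.span_induct_alt)
        case base
        show ?case by (simp add: Q.span_zero)
      next
        case (step c x y)
        then obtain Y where Y: "x = arc_poly Y" "cut_free A' Y" by blast
        have "cut_free A (add_mset (i, j) Y)"
          unfolding cut_free_def
        proof (intro conjI allI impI notI)
          show "add_mset (i, j) Y \<subseteq># A" using Y(2) by (simp add: A cut_free_def)
          fix S
          assume S: "arc_cut A S \<noteq> {#}" "arc_cut A S \<subseteq># add_mset (i, j) Y"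
          have "arc_cut A' S \<noteq> {#}"
            using S(1) no_bridge by (auto simp: A arc_cut_add_mset split: if_splits)
          moreover have "arc_cut A' S \<subseteq># Y"
          proof (cases "(i \<in> S) = (j \<in> S)")
            case True
            have "arc_cut (arc_cut A' S) S \<subseteq># arc_cut (add_mset (i, j) Y) S"
              using S(2) True by (intro arc_cut_mono) (simp add: A arc_cut_add_mset)
            moreover have "arc_cut (arc_cut A' S) S = arc_cut A' S" by (simp add: arc_cut_def filter_filter_mset)
            moreover have "arc_cut (add_mset (i, j) Y) S \<subseteq># Y"
              using True arc_cut_subset[of Y S] by (simp add: arc_cut_add_mset)
            ultimately show ?thesis by (metis subset_mset.order_trans)
          next
            case False
            then show ?thesis using S(2) by (simp add: A arc_cut_add_mset)
          qed
          ultimately show False using Y(2) by (simp add: cut_free_def)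
        qed
        then have "?l * x \<in> Q.span {arc_poly Y |Y. cut_free A Y}"
          using Y(1) by (intro Q.span_base) (auto simp: arc_poly_add_mset[symmetric])
        moreover have "?l * (pscale c x + y) = pscale c (?l * x) + ?l * y"
          by (simp add: pscale_def distrib_left mult.left_commute)
        ultimately show ?case using step(2) by (simp add: Q.span_add Q.span_scale)
      qed
    qed
    then have "p + ?l * h \<in> arc_space A"
      using p(1) by (simp add: arc_space_def rat_span_def Q.span_add)
    then show ?thesis using h by (simp add: algebra_simps)
  qed
qed

section \<open>Cuts and connectedness\<close>

lemma card_2_Min_Max:
  assumes "card (e :: 'n::linorder set) = 2"
  shows "e = {Min e, Max e}" "Min e \<noteq> Max e"
proof -
  obtain a b where "e = {a, b}" "a \<noteq> b" using assms by (meson card_2_iff)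
  then have "Min e = min a b" "Max e = max a b" by simp_all
  with \<open>e = {a, b}\<close> \<open>a \<noteq> b\<close> show "e = {Min e, Max e}" "Min e \<noteq> Max e"
    by (auto simp: min_def max_def)
qed

lemma loopless_subset: "loopless E \<Longrightarrow> Y \<subseteq># E \<Longrightarrow> loopless Y"
  using mset_subset_eqD by (fastforce simp: loopless_def)

lemma loopless_edgeE:
  assumes "loopless E" "e \<in># E"
  obtains a b where "e = {a, b}" "a \<noteq> b"
  using assms unfolding loopless_def by (metis card_2_iff)

lemma cut_Compl: "cut E (- S) = cut E S"
  by (auto simp: cut_def intro: filter_mset_cong)

lemma cut_subset: "cut E S \<subseteq># E"
  by (simp add: cut_def)

lemma cut_trivial [simp]: "cut E {} = {#}" "cut E UNIV = {#}"
  by (simp_all add: cut_def)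

lemma connected_graph_UNIV_cut:
  assumes "connected_graph UNIV F" "S \<noteq> {}" "S \<noteq> UNIV"
  shows "cut F S \<noteq> {#}"
proof
  assume c: "cut F S = {#}"
  obtain u v where uv: "u \<in> S" "v \<notin> S" using assms(2,3) by blast
  have "(u, v) \<in> {(a, b). {a, b} \<in># F}\<^sup>*" using assms(1) by (simp add: connected_graph_def)
  then have "v \<in> S"
  proof (induction rule: rtrancl_induct)
    case (step y z)
    then have "{y, z} \<in># F" by simp
    moreover have "{y, z} \<notin># cut F S" using c by simp
    ultimately show ?case using step.IH by (auto simp: cut_def)
  qed (rule uv)
  then show False using uv(2) by simp
qed

text \<open>
  If no cut is empty, the set of vertices reachable from a given one cannot be a proper subset.
\<close>

lemma connected_graph_UNIV_iff_cut:
  assumes "loopless F"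
  shows "connected_graph UNIV F \<longleftrightarrow> (\<forall>S. S \<noteq> {} \<and> S \<noteq> UNIV \<longrightarrow> cut F S \<noteq> {#})"
proof
  assume c: "\<forall>S. S \<noteq> {} \<and> S \<noteq> UNIV \<longrightarrow> cut F S \<noteq> {#}"
  have "{v. (u, v) \<in> {(a, b). {a, b} \<in># F}\<^sup>*} = UNIV" (is "?S = UNIV") for u
  proof (rule ccontr)
    assume "?S \<noteq> UNIV"
    moreover have "?S \<noteq> {}" by auto
    ultimately obtain e where e: "e \<in># cut F ?S" using c by (meson multiset_nonemptyE)
    then have eF: "e \<in># F" and ex: "e \<inter> ?S \<noteq> {}" "e \<inter> - ?S \<noteq> {}" by (simp_all add: cut_def)
    obtain a b where "e = {a, b}" using loopless_edgeE[OF assms eF] by blast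
    then obtain x y where xy: "e = {x, y}" "x \<in> ?S" "y \<notin> ?S" using ex by auto
    then have "(u, y) \<in> {(a, b). {a, b} \<in># F}\<^sup>*" using eF by (auto intro: rtrancl_into_rtrancl)
    then show False using xy(3) by simp
  qed
  then show "connected_graph UNIV F" by (auto simp: connected_graph_def)
qed (use connected_graph_UNIV_cut in blast)

lemma slim_iff_no_cut:
  assumes "loopless E" "connected_graph UNIV E"
  shows "slim E Y \<longleftrightarrow> Y \<subseteq># E \<and> (\<forall>S. cut E S \<noteq> {#} \<longrightarrow> \<not> cut E S \<subseteq># Y)"
proof (cases "Y \<subseteq># E")
  case True
  have l: "loopless (E - Y)" using loopless_subset[OF assms(1), of "E - Y"] by simp
  have eq: "cut (E - Y) S = {#} \<longleftrightarrow> cut E S \<subseteq># Y" for S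
  proof -
    have "cut (E - Y) S = cut E S - cut Y S" by (simp add: cut_def filter_diff_mset)
    then have "cut (E - Y) S = {#} \<longleftrightarrow> cut E S \<subseteq># cut Y S" by (simp add: Diff_eq_empty_iff_mset)
    also have "\<dots> \<longleftrightarrow> cut E S \<subseteq># Y"
    proof
      assume "cut E S \<subseteq># Y"
      then have "cut (cut E S) S \<subseteq># cut Y S" unfolding cut_def by (rule multiset_filter_mono)
      then show "cut E S \<subseteq># cut Y S" by (simp add: cut_def filter_filter_mset)
    qed (use cut_subset subset_mset.order_trans in blast)
    finally show ?thesis .
  qed
  have triv: "cut E S \<noteq> {#} \<longleftrightarrow> S \<noteq> {} \<and> S \<noteq> UNIV" for S
    using connected_graph_UNIV_cut[OF assms(2), of S] by auto
  show ?thesis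
    using True by (simp add: slim_def connected_graph_UNIV_iff_cut[OF l] eq triv)
qed (simp add: slim_def)

text \<open>
  The orientation that is built into \<open>p_poly\<close>.
\<close>

definition arcs :: "'n::linorder set multiset \<Rightarrow> ('n \<times> 'n) multiset" where
  "arcs E = image_mset (\<lambda>e. (Min e, Max e)) E"

lemma size_arcs [simp]: "size (arcs E) = size E"
  by (simp add: arcs_def)

lemma p_poly_arcs: "p_poly Y = arc_poly (arcs Y)"
  by (simp add: p_poly_def arc_poly_def arcs_def arc_form_def multiset.map_comp comp_def)

lemma arc_cut_arcs:
  assumes "loopless E"
  shows "arc_cut (arcs E) S = arcs (cut E S)"
proof -
  have "(Min e \<in> S) \<noteq> (Max e \<in> S) \<longleftrightarrow> e \<inter> S \<noteq> {} \<and> e \<inter> - S \<noteq> {}" if "e \<in># E" for e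
  proof -
    obtain a b where ab: "Min e = a" "Max e = b" by simp
    have "card e = 2" using assms that by (simp add: loopless_def)
    then have "e = {a, b}" using card_2_Min_Max(1)[of e] ab by simp
    then show ?thesis unfolding ab by auto
  qed
  then show ?thesis
    unfolding arc_cut_def arcs_def cut_def filter_mset_image_mset
    by (intro arg_cong[where f = "image_mset _"] filter_mset_cong) auto
qed

lemma arcs_inverse:
  assumes "loopless E"
  shows "image_mset (\<lambda>(a, b). {a, b}) (arcs E) = E"
proof -
  have "image_mset (\<lambda>(a, b). {a, b}) (arcs E) = image_mset (\<lambda>e. {Min e, Max e}) E"
    by (simp add: arcs_def multiset.map_comp comp_def)
  also have "\<dots> = image_mset (\<lambda>e. e) E"
    using assms card_2_Min_Max(1) by (intro image_mset_cong) (fastforce simp: loopless_def)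
  finally show ?thesis by simp
qed

lemma arcs_subset_iff:
  assumes "loopless E" "loopless Y"
  shows "arcs Y \<subseteq># arcs E \<longleftrightarrow> Y \<subseteq># E"
proof
  assume "arcs Y \<subseteq># arcs E"
  from image_mset_subseteq_mono[OF this, of "\<lambda>(a, b). {a, b}"] show "Y \<subseteq># E"
    unfolding arcs_inverse[OF assms(1)] arcs_inverse[OF assms(2)] .
next
  assume "Y \<subseteq># E"
  then show "arcs Y \<subseteq># arcs E" unfolding arcs_def by (rule image_mset_subseteq_mono)
qed

lemma cut_free_arcs:
  assumes "loopless E" "connected_graph UNIV E" "loopless Y"
  shows "cut_free (arcs E) (arcs Y) \<longleftrightarrow> slim E Y"
proof -
  have "arcs (cut E S) = {#} \<longleftrightarrow> cut E S = {#}" for S by (simp add: arcs_def)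
  moreover have "loopless (cut E S)" for S by (rule loopless_subset[OF assms(1) cut_subset])
  ultimately show ?thesis
    using assms by (simp add: cut_free_def slim_iff_no_cut arcs_subset_iff arc_cut_arcs)
qed

lemma slim_space_arc_space:
  assumes "loopless E" "connected_graph UNIV E"
  shows "slim_space E = arc_space (arcs E)"
proof -
  have "\<exists>Y. Z = arcs Y \<and> slim E Y" if Z: "cut_free (arcs E) Z" for Z
  proof -
    obtain W where "arcs E = Z + W" using Z by (auto simp: cut_free_def subset_mset.le_iff_add)
    then obtain Y W' where "E = Y + W'" "Z = arcs Y"
      unfolding arcs_def using image_mset_eq_plusD by blast
    then show ?thesis using cut_free_arcs[OF assms, of Y] Z loopless_subset[OF assms(1), of Y] by auto
  qed
  moreover have "cut_free (arcs E) (arcs Y)" if "slim E Y" for Y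
    using that cut_free_arcs[OF assms, of Y] loopless_subset[OF assms(1), of Y] by (simp add: slim_def)
  ultimately have "{p_poly Y |Y. slim E Y} = {arc_poly Y |Y. cut_free (arcs E) Y}"
    unfolding p_poly_arcs by blast
  then show ?thesis by (simp add: slim_space_def arc_space_def)
qed

section \<open>Powers of all cuts lie in the power ideal\<close>

lemma ideal_gen_base: "f \<in> S \<Longrightarrow> f \<in> ideal_gen S"
  unfolding ideal_gen_def by (rule module.span_base[OF module_times])

lemma ideal_gen_uminus: "f \<in> ideal_gen S \<Longrightarrow> - f \<in> ideal_gen S"
  unfolding ideal_gen_def by (rule module.span_neg[OF module_times])

lemma ideal_gen_sum: "(\<And>k. k \<in> K \<Longrightarrow> f k \<in> ideal_gen S) \<Longrightarrow> sum f K \<in> ideal_gen S"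
  unfolding ideal_gen_def by (rule module.span_sum[OF module_times])

lemma ideal_gen_pscale: "f \<in> ideal_gen S \<Longrightarrow> pscale c f \<in> ideal_gen S"
  unfolding pscale_def by (rule ideal_gen_mult)

lemma ideal_gen_mult_right: "f \<in> ideal_gen S \<Longrightarrow> f * h \<in> ideal_gen S"
  using ideal_gen_mult[of f S h] by (simp add: mult.commute)

lemma ideal_gen_induct [consumes 1, case_names zero step]:
  assumes "f \<in> ideal_gen S" "P 0" "\<And>h g f. g \<in> S \<Longrightarrow> f \<in> ideal_gen S \<Longrightarrow> P f \<Longrightarrow> P (h * g + f)"
  shows "P f"
proof -
  have "f \<in> ideal_gen S \<and> P f"
    using assms(1) unfolding ideal_gen_def
  proof (induction rule: module.span_induct_alt[OF module_times, consumes 1, case_names base step])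
    case base
    then show ?case using assms(2) module.span_zero[OF module_times] by auto
  next
    case (step h g f)
    then show ?case using assms(3)[of g f h] ideal_gen_add[of "h * g" S f] ideal_gen_mult[of g S h] ideal_gen_base[of g S]
      by (simp add: ideal_gen_def)
  qed
  then show ?thesis ..
qed

lemma ideal_gen_subset: "S \<subseteq> ideal_gen T \<Longrightarrow> ideal_gen S \<subseteq> ideal_gen T"
  by (rule subsetI, erule ideal_gen_induct) (auto intro: ideal_gen_closed)

text \<open>
  In each term of the binomial expansion one of the two exponents is large enough.
\<close>

lemma ideal_gen_power_sum:
  assumes "f ^ a \<in> ideal_gen S" "g ^ b \<in> ideal_gen S"
  shows "(f + g) ^ (a + b) \<in> ideal_gen S"
  unfolding binomial_ring
proof (rule ideal_gen_sum)
  fix k assume "k \<in> {..a + b}"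
  show "of_nat (a + b choose k) * f ^ k * g ^ (a + b - k) \<in> ideal_gen S"
  proof (cases "a \<le> k")
    case True
    then have "f ^ k = f ^ a * f ^ (k - a)" by (metis le_add_diff_inverse power_add)
    then show ?thesis using assms(1) by (simp add: ideal_gen_mult ideal_gen_mult_right)
  next
    case False
    then have "a + b - k = b + (a - k)" by simp
    then have "g ^ (a + b - k) = g ^ b * g ^ (a - k)" by (simp only: power_add)
    then show ?thesis using assms(2) by (simp add: ideal_gen_mult ideal_gen_mult_right)
  qed
qed

lemma ideal_gen_power_cong:
  assumes "f - g \<in> ideal_gen S" "g ^ k \<in> ideal_gen S"
  shows "f ^ k \<in> ideal_gen S"
proof -
  have "f ^ k - g ^ k \<in> ideal_gen S"
    unfolding power_diff_sumr2 using assms(1) by (rule ideal_gen_mult_right)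
  then show ?thesis using ideal_gen_add[OF _ assms(2)] by fastforce
qed

lemma xsum_disjoint: "A \<inter> B = {} \<Longrightarrow> xsum (A \<union> B :: 'n::finite set) = xsum A + xsum B"
  unfolding xsum_def by (rule sum.union_disjoint) auto

text \<open>
  If every edge that crosses \<open>S'\<close> also crosses \<open>S\<close>, then no edge joins the two parts into which \<open>S'\<close>
  divides \<open>S\<close>, so the edges leaving \<open>S\<close> are distributed over the two parts.
\<close>

lemma cut_split:
  assumes "loopless E" "cut E S' \<subseteq># cut E S"
  shows "cut E S = cut E (S \<inter> S') + cut E (S - S')"
proof (rule multiset_eqI)
  fix e
  show "count (cut E S) e = count (cut E (S \<inter> S') + cut E (S - S')) e"
  proof (cases "e \<in># E")
    case True
    then obtain a b where e: "e = {a, b}" using loopless_edgeE[OF assms(1)] by blast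
    have cross: "e \<inter> T \<noteq> {} \<and> e \<inter> - T \<noteq> {} \<longleftrightarrow> (a \<in> T) \<noteq> (b \<in> T)" for T
      unfolding e by blast
    have c: "count (cut E T) e = (if (a \<in> T) \<noteq> (b \<in> T) then count E e else 0)" for T
      by (simp only: cut_def count_filter_mset cross)
    have "count (cut E S') e \<le> count (cut E S) e" using assms(2) by (rule mset_subset_eq_count)
    then have "(a \<in> S') \<noteq> (b \<in> S') \<Longrightarrow> (a \<in> S) \<noteq> (b \<in> S)"
      using True by (simp add: c count_eq_zero_iff split: if_splits)
    then show ?thesis by (auto simp: c)
  next
    case False
    then show ?thesis by (simp add: cut_def not_in_iff)
  qed
qed

text \<open>
  A cut that is not a bond contains a smaller nonempty cut \<open>\<partial>(S')\<close>, and \<open>S'\<close> divides \<open>S\<close> or the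
  complement of \<open>S\<close> into two nonempty parts with no edges between them. Cut sizes add up, and so do the
  exponents in \<open>ideal_gen_power_sum\<close>. Passing to the complement only changes the sign of \<open>x\<^sub>S\<close> modulo
  \<open>x\<^bsub>[n]\<^esub>\<close>.
\<close>

lemma xsum_power_in_power_ideal:
  assumes E: "loopless E" "connected_graph UNIV E" and S: "S \<noteq> {}" "S \<noteq> UNIV"
  shows "xsum S ^ size (cut E S) \<in> power_ideal E"
  using S
proof (induction "size (cut E S)" arbitrary: S rule: less_induct)
  case less
  note ne = connected_graph_UNIV_cut[OF E(2)]
  note gen = power_ideal_def[of E]
  show ?case
  proof (cases "is_bond E (cut E S)")
    case True
    then show ?thesis unfolding gen using less.prems by (intro ideal_gen_base) blast
  next
    case False
    then obtain S' where S': "S' \<noteq> {}" "S' \<noteq> UNIV" "cut E S' \<subseteq># cut E S" "cut E S' \<noteq> cut E S"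
      using less.prems ne[OF less.prems] unfolding is_bond_def by blast
    have split: "xsum T ^ size (cut E T) \<in> power_ideal E"
      if T: "T \<inter> S' \<noteq> {}" "T - S' \<noteq> {}" "T \<noteq> UNIV" "cut E T = cut E S" for T
    proof -
      have c: "cut E T = cut E (T \<inter> S') + cut E (T - S')"
        using cut_split[OF E(1), of S' T] S'(3) T(4) by simp
      have "T \<inter> S' \<noteq> UNIV" "T - S' \<noteq> UNIV" using T S' by auto
      then have pos: "cut E (T \<inter> S') \<noteq> {#}" "cut E (T - S') \<noteq> {#}" using ne T by auto
      have "size (cut E (T \<inter> S')) < size (cut E S)" "size (cut E (T - S')) < size (cut E S)"
        using pos c T(4)[symmetric] by (simp_all add: nonempty_has_size)
      then have "xsum (T \<inter> S') ^ size (cut E (T \<inter> S')) \<in> power_ideal E"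
          "xsum (T - S') ^ size (cut E (T - S')) \<in> power_ideal E"
        using less.hyps T(1,2) \<open>T \<inter> S' \<noteq> UNIV\<close> \<open>T - S' \<noteq> UNIV\<close> by blast+
      moreover have "xsum T = xsum (T \<inter> S') + xsum (T - S')"
        using xsum_disjoint[of "T \<inter> S'" "T - S'"] by (simp add: Int_Diff_Un Int_Diff_disjoint)
      ultimately show ?thesis unfolding c gen by (simp add: ideal_gen_power_sum)
    qed
    show ?thesis
    proof (cases "S \<inter> S' \<noteq> {} \<and> S - S' \<noteq> {}")
      case True
      then show ?thesis using split less.prems by blast
    next
      case no: False
      have "- S \<inter> S' \<noteq> {} \<and> - S - S' \<noteq> {}"
      proof (rule ccontr)
        assume "\<not> ?thesis"
        with no have "S' = {} \<or> S' = UNIV \<or> S' = S \<or> S' = - S" by blast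
        then show False using S' cut_Compl[of E S] by auto
      qed
      then have "xsum (- S) ^ size (cut E S) \<in> power_ideal E"
        using split[of "- S"] less.prems by (auto simp: cut_Compl)
      then have "(- xsum (- S)) ^ size (cut E S) \<in> power_ideal E"
        unfolding power_minus[of "xsum (- S)"] gen by (rule ideal_gen_mult)
      moreover have "xsum S - (- xsum (- S)) \<in> power_ideal E"
        using xsum_disjoint[of S "- S"] by (simp add: gen ideal_gen_base)
      ultimately show ?thesis unfolding gen by (rule ideal_gen_power_cong[rotated])
    qed
  qed
qed

section \<open>The power ideal is the orthogonal complement of the slim subgraph space\<close>

lemma xsum_max_power_in_power_ideal:
  assumes "loopless E" "connected_graph UNIV E"
  shows "xsum S ^ max 1 (size (cut E S)) \<in> power_ideal E"
proof -
  consider "S = {}" | "S = UNIV" | "S \<noteq> {}" "S \<noteq> UNIV" by blast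
  then show ?thesis
  proof cases
    case 1
    then show ?thesis by (simp add: xsum_def power_ideal_def ideal_gen_0)
  next
    case 2
    then show ?thesis by (simp add: power_ideal_def ideal_gen_base)
  next
    case 3
    then have "size (cut E S) \<ge> 1"
      using connected_graph_UNIV_cut[OF assms(2)] by (simp add: Suc_le_eq nonempty_has_size)
    then show ?thesis using xsum_power_in_power_ideal[OF assms 3] by (simp add: max_absorb2)
  qed
qed

lemma homogeneous_p_poly: "homogeneous (size Y) (p_poly Y)"
proof (induction Y)
  case empty
  then show ?case by (simp add: p_poly_def homogeneous_1)
next
  case (add e Y)
  have "homogeneous (1 + size Y) ((PVar (Min e) - PVar (Max e)) * p_poly Y)"
    by (intro homogeneous_mult homogeneous_linear(3) homogeneous_PVar add)
  then show ?case by (simp add: p_poly_def)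
qed

lemma hcomponent_slim_space: "p \<in> slim_space E \<Longrightarrow> hcomponent d p \<in> slim_space E"
  unfolding slim_space_def rat_span_def
proof (induction rule: Q.span_induct_alt)
  case base
  then show ?case by (simp add: Q.span_zero)
next
  case (step c x y)
  then obtain Y where Y: "x = p_poly Y" "slim E Y" by blast
  then have "hcomponent d x = (if d = size Y then x else 0)"
    by (simp add: hcomponent_homogeneous[OF homogeneous_p_poly])
  then have "hcomponent d x \<in> Q.span {p_poly Y |Y. slim E Y}"
    using step(1) by (simp add: Q.span_base Q.span_zero)
  then show ?case using step(2) by (simp add: Q.span_add Q.span_scale)
qed

text \<open>
  By adjointness, pairing a multiple of a power of \<open>x\<^sub>S\<close> with \<open>p\<close> differentiates \<open>p\<close> along \<open>S\<close> that many
  times.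
\<close>

lemma power_ideal_pairing_slim:
  assumes E: "loopless E" "connected_graph UNIV E"
    and f: "f \<in> power_ideal E" and p: "p \<in> slim_space E"
  shows "pairing f p = 0"
proof -
  have ann: "(dirderiv S ^^ max 1 (size (cut E S))) p = 0" for S
    using arc_space_annihilated[of p "arcs E"] p
    by (simp add: slim_space_arc_space[OF E] cut_annihilated_def arc_cut_arcs[OF E(1)])
  have gen: "pairing (h * xsum S ^ max 1 (size (cut E S))) p = 0" for h S
    by (simp only: mult.commute[of h] pairing_xsum_power_mult ann pairing_zero)
  show ?thesis
    using f unfolding power_ideal_def
  proof (induction rule: ideal_gen_induct)
    case (step h g f)
    have "g = xsum UNIV \<or> (\<exists>S. g = xsum S ^ max 1 (size (cut E S)))"
    proof (cases "g = xsum UNIV")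
      case False
      then obtain S where S: "g = xsum S ^ size (cut E S)" "S \<noteq> {}" "S \<noteq> UNIV" using step(1) by blast
      then have "max 1 (size (cut E S)) = size (cut E S)"
        using connected_graph_UNIV_cut[OF E(2), of S] by (simp add: nonempty_has_size max_def Suc_le_eq)
      then show ?thesis using S(1) by metis
    qed simp
    then have "pairing (h * g) p = 0" using gen gen[of h UNIV] by auto
    then show ?case using step by (simp add: pairing_add_left)
  qed simp
qed

text \<open>
  In infinite dimension an ideal need not be its own double complement, so the work is done in one
  degree \<open>d\<close> at a time, where projections exist. The difference \<open>w\<close> between a component of \<open>f\<close> and its
  projection on the ideal is annihilated by the operators of all cuts, hence slim; but it is also
  orthogonal to the slim space.
\<close>

theorem power_ideal_eq_orthogonal:
  assumes E: "loopless E" "connected_graph UNIV E"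
  shows "power_ideal E = {f. \<forall>p\<in>slim_space E. pairing f p = 0}"
proof (intro equalityI subsetI CollectI ballI)
  fix f assume "f \<in> {f. \<forall>p\<in>slim_space E. pairing f p = 0}"
  then have f: "pairing f p = 0" if "p \<in> slim_space E" for p using that by blast
  have "hcomponent d f \<in> power_ideal E" for d
  proof -
    let ?U = "{u \<in> power_ideal E. homogeneous d u}"
    have sub: "Q.subspace ?U"
      by (auto simp: Q.subspace_def power_ideal_def ideal_gen_0 ideal_gen_add ideal_gen_pscale homogeneous_linear)
    have fin: "finite ((\<lambda>m. Poly_Mapping.single m 1) ` {m :: 'a \<Rightarrow>\<^sub>0 nat. mdeg m = d})"
      by (intro finite_imageI finite_exponents)
    have "?U \<subseteq> rat_span ((\<lambda>m. Poly_Mapping.single m 1) ` {m. mdeg m = d})"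
      using homogeneous_in_monomial_span by blast
    then obtain u where u: "u \<in> ?U" "\<And>w. w \<in> ?U \<Longrightarrow> pairing (hcomponent d f - u) w = 0"
      using orthogonal_projection_subspace[OF sub fin] by blast
    define w where "w = hcomponent d f - u"
    have w: "homogeneous d w" using u(1) by (simp add: w_def homogeneous_linear)
    \<comment> \<open>A polynomial is zero if it is orthogonal to itself; adjointness moves the derivatives to an element of the ideal.\<close>
    have "(dirderiv S ^^ max 1 (size (cut E S))) w = 0" for S
    proof (rule pairing_self_eq_0)
      let ?k = "max 1 (size (cut E S))"
      let ?v = "(dirderiv S ^^ ?k) w"
      have x: "homogeneous ?k (xsum S ^ ?k)" using homogeneous_power[OF homogeneous_xsum[of S], of ?k] by simp
      have "pairing ?v ?v = pairing (?v * xsum S ^ ?k) w"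
        by (simp only: mult.commute[of ?v] pairing_xsum_power_mult)
      also have "\<dots> = pairing w (hcomponent d (?v * xsum S ^ ?k))"
        using pairing_homogeneous[OF w] pairing_commute by metis
      also have "\<dots> = 0"
      proof (cases "?k \<le> d")
        case True
        then have eq: "hcomponent d (?v * xsum S ^ ?k) = hcomponent (d - ?k) ?v * xsum S ^ ?k"
          by (simp only: hcomponent_mult_homogeneous[OF x] if_True)
        have "hcomponent d (?v * xsum S ^ ?k) \<in> power_ideal E"
          unfolding eq using xsum_max_power_in_power_ideal[OF E, of S]
          unfolding power_ideal_def by (rule ideal_gen_mult)
        then show ?thesis using u(2)[of "hcomponent d (?v * xsum S ^ ?k)"] by (simp add: w_def)
      next
        case False
        then show ?thesis by (simp only: hcomponent_mult_homogeneous[OF x] if_False pairing_zero)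
      qed
      finally show "pairing ?v ?v = 0" .
    qed
    then have "w \<in> slim_space E"
      using cut_annihilated_imp_arc_space[of "arcs E" w]
      by (simp add: slim_space_arc_space[OF E] cut_annihilated_def arc_cut_arcs[OF E(1)])
    then have "pairing (hcomponent d f) w = 0" "pairing u w = 0"
      using f hcomponent_slim_space[of w E d] power_ideal_pairing_slim[OF E] u(1)
      by (simp_all add: pairing_hcomponent)
    then have "pairing w w = 0" by (subst w_def) (simp only: pairing_diff_left)
    then have "w = 0" by (rule pairing_self_eq_0)
    then show ?thesis using u(1) by (simp add: w_def)
  qed
  moreover obtain N where "degree_less N f" using degree_less_ex by blast
  ultimately show "f \<in> power_ideal E"
    using ideal_gen_sum[of "{..<N}" "\<lambda>d. hcomponent d f"] by (simp add: sum_hcomponents power_ideal_def)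
qed (rule power_ideal_pairing_slim[OF E])

lemma slim_space_Int_power_ideal:
  assumes "loopless E" "connected_graph UNIV E" "p \<in> slim_space E" "p \<in> power_ideal E"
  shows "p = 0"
  using assms by (intro pairing_self_eq_0) (simp add: power_ideal_eq_orthogonal)

lemma finite_submultisets: "finite {Y. Y \<subseteq># E}"
proof (induction E)
  case (add e E)
  have "{Y. Y \<subseteq># add_mset e E} \<subseteq> {Y. Y \<subseteq># E} \<union> add_mset e ` {Y. Y \<subseteq># E}"
  proof
    fix Y assume "Y \<in> {Y. Y \<subseteq># add_mset e E}"
    then have "Y - {#e#} \<subseteq># E" by (simp add: subset_eq_diff_conv)
    then show "Y \<in> {Y. Y \<subseteq># E} \<union> add_mset e ` {Y. Y \<subseteq># E}"
      by (cases "e \<in># Y") (auto dest!: multi_member_split)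
  qed
  then show ?case using add by (auto intro: finite_subset)
qed simp

lemma slim_space_power_ideal_decomposition:
  assumes "loopless E" "connected_graph UNIV E"
  obtains p where "p \<in> slim_space E" "f - p \<in> power_ideal E"
proof -
  have "finite (p_poly ` {Y. Y \<subseteq># E})" by (intro finite_imageI finite_submultisets)
  then have "finite {p_poly Y |Y. slim E Y}"
    by (rule rev_finite_subset) (auto simp: slim_def)
  from orthogonal_projection[OF this, of f] that show ?thesis
    unfolding power_ideal_eq_orthogonal[OF assms] slim_space_def by blast
qed

section \<open>Break divisors from spanning trees\<close>

definition edges_in :: "'n set multiset \<Rightarrow> 'n set \<Rightarrow> 'n set multiset" where
  "edges_in E V = {#e \<in># E. e \<subseteq> V#}"

text \<open>
  What is needed from a divisor that is obtained by moving every edge of \<open>M\<close> to one of its endpoints: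
  an edge inside \<open>V\<close> contributes to \<open>V\<close> whatever it chooses. These two properties persist when an edge
  makes its choice, so the choices themselves need not be recorded.
\<close>

definition endpoint_divisor :: "'n::finite set multiset \<Rightarrow> ('n \<Rightarrow> nat) \<Rightarrow> bool" where
  "endpoint_divisor M D \<longleftrightarrow> (\<Sum>v\<in>UNIV. D v) = size M \<and> (\<forall>V. size (edges_in M V) \<le> (\<Sum>v\<in>V. D v))"

lemma edges_in_add_mset:
  "edges_in (add_mset e M) V = (if e \<subseteq> V then add_mset e (edges_in M V) else edges_in M V)"
  by (simp add: edges_in_def)

lemma sum_fun_upd_Suc:
  fixes D :: "'n::finite \<Rightarrow> nat"
  shows "sum (D(v := Suc (D v))) V = (if v \<in> V then 1 else 0) + sum D V"
proof -
  have "sum (D(v := Suc (D v))) V = (\<Sum>k\<in>V. (if v = k then 1 else 0) + D k)"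
    by (intro sum.cong) auto
  then show ?thesis by (simp add: sum.distrib)
qed

lemma endpoint_divisor_add:
  assumes "endpoint_divisor M D" "v \<in> e"
  shows "endpoint_divisor (add_mset e M) (D(v := Suc (D v)))"
  using assms unfolding endpoint_divisor_def
  by (auto simp: sum_fun_upd_Suc edges_in_add_mset le_SucI simp del: fun_upd_apply)

lemma endpoint_divisor_ex:
  assumes "loopless M"
  shows "\<exists>D. endpoint_divisor M D"
  using assms
proof (induction M)
  case empty
  show ?case by (rule exI[of _ "\<lambda>_. 0"]) (simp add: endpoint_divisor_def edges_in_def)
next
  case (add e M)
  then obtain D where "endpoint_divisor M D" by (auto simp: loopless_def)
  moreover have "e \<noteq> {}" using add.prems by (auto simp: loopless_def)
  ultimately show ?case using endpoint_divisor_add by blast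
qed

text \<open>
  On at least one vertex, a forest has fewer edges than vertices.
\<close>

definition forest :: "'n set multiset \<Rightarrow> bool" where
  "forest T \<longleftrightarrow> (\<forall>V. V \<noteq> {} \<longrightarrow> size (edges_in T V) < card V)"

text \<open>
  Grow the tree from a vertex, adding an edge of the cut of the vertices \<open>W\<close> reached so far. The new
  vertex \<open>y\<close> lies on no other tree edge, so a vertex set containing it gains one vertex and at most one
  edge.
\<close>

lemma spanning_tree_ex:
  fixes F :: "'n::finite set multiset"
  assumes F: "loopless F" "connected_graph UNIV F"
  obtains T where "T \<subseteq># F" "Suc (size T) = card (UNIV :: 'n set)" "forest T"
proof -
  have "\<exists>W T. card W = k \<and> T \<subseteq># F \<and> Suc (size T) = k \<and> (\<forall>e\<in>#T. e \<subseteq> W) \<and> forest T"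
    if "1 \<le> k" "k \<le> card (UNIV :: 'n set)" for k
    using that
  proof (induction k rule: dec_induct)
    case base
    show ?case by (rule exI[of _ "{undefined}"], rule exI[of _ "{#}"])
      (simp add: forest_def edges_in_def card_gt_0_iff)
  next
    case (step k)
    then obtain W T where W: "card W = k" "T \<subseteq># F" "Suc (size T) = k" "\<forall>e\<in>#T. e \<subseteq> W" "forest T"
      by auto
    have "W \<noteq> {}" "W \<noteq> UNIV" using W(1) step by auto
    then obtain e where "e \<in># cut F W"
      using connected_graph_UNIV_cut[OF F(2)] by (meson multiset_nonemptyE)
    then have eF: "e \<in># F" and ex: "e \<inter> W \<noteq> {}" "e \<inter> - W \<noteq> {}" by (simp_all add: cut_def)
    obtain a b where "e = {a, b}" using loopless_edgeE[OF F(1) eF] by blast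
    then obtain x y where xy: "e = {x, y}" "x \<in> W" "y \<notin> W" using ex by auto
    have eT: "e \<notin># T" using W(4) xy by auto
    have "add_mset e T \<subseteq># F"
      unfolding subseteq_mset_def
    proof
      fix e'
      show "count (add_mset e T) e' \<le> count F e'"
        using mset_subset_eq_count[OF W(2), of e'] eT eF by (auto simp: not_in_iff Suc_le_eq)
    qed
    moreover have "forest (add_mset e T)"
      unfolding forest_def
    proof (intro allI impI)
      fix V :: "'n set" assume V: "V \<noteq> {}"
      show "size (edges_in (add_mset e T) V) < card V"
      proof (cases "e \<subseteq> V")
        case True
        have "edges_in T V = edges_in T (V - {y})"
          unfolding edges_in_def using W(4) xy(3) by (intro filter_mset_cong) auto
        moreover have "V - {y} \<noteq> {}" using True xy by auto
        ultimately have "size (edges_in T V) < card (V - {y})" using W(5) by (metis forest_def)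
        moreover have "card V = Suc (card (V - {y}))" using True xy card_Suc_Diff1[of V y] by simp
        ultimately show ?thesis using True by (simp add: edges_in_add_mset)
      next
        case False
        then show ?thesis using W(5) V by (simp add: edges_in_add_mset forest_def)
      qed
    qed
    moreover have "card (insert y W) = Suc k" using W(1) xy(3) by simp
    moreover have "\<forall>e'\<in>#add_mset e T. e' \<subseteq> insert y W" using W(4) xy by auto
    ultimately show ?case using W(3) by (intro exI[of _ "insert y W"] exI[of _ "add_mset e T"]) simp
  qed
  moreover have "1 \<le> card (UNIV :: 'n set)" by (simp add: Suc_le_eq card_gt_0_iff)
  ultimately show ?thesis using that by blast
qed

text \<open>
  The edges inside \<open>V\<close> that are not in the tree are counted by \<open>D(V)\<close>, and at most \<open>|V| - 1\<close> edges
  inside \<open>V\<close> are in the tree. This is the inequality required of a break divisor.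
\<close>

lemma endpoint_divisor_break:
  fixes E :: "'n::finite set multiset"
  assumes T: "T \<subseteq># E" "Suc (size T) = card (UNIV :: 'n set)" "forest T" and D: "endpoint_divisor (E - T) D"
  shows "D \<in> break_divisors E"
proof -
  have sz: "size E = size (E - T) + size T" using T(1) by (simp add: size_Diff_submset size_mset_mono)
  have "(\<Sum>v\<in>UNIV. int (D v)) = genus UNIV E"
    using D T(2) sz by (simp add: endpoint_divisor_def genus_def flip: of_nat_sum)
  moreover have "genus V F \<le> (\<Sum>v\<in>V. int (D v))" if "connected_subgraph E V F" for V F
  proof -
    have F: "F \<subseteq># E" "\<forall>e\<in>#F. e \<subseteq> V" "V \<noteq> {}"
      using that by (simp_all add: connected_subgraph_def connected_graph_def)
    have "edges_in F V \<subseteq># edges_in E V" unfolding edges_in_def by (rule multiset_filter_mono[OF F(1)])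
    moreover have "edges_in F V = F" using F(2) by (simp add: edges_in_def filter_mset_eq_conv)
    ultimately have "size F \<le> size (edges_in E V)" using size_mset_mono by metis
    also have "edges_in E V = edges_in (E - T) V + edges_in T V"
      unfolding edges_in_def filter_union_mset[symmetric] using T(1) by simp
    finally have "size F \<le> size (edges_in (E - T) V) + size (edges_in T V)" by simp
    moreover have "size (edges_in (E - T) V) \<le> (\<Sum>v\<in>V. D v)" using D by (simp add: endpoint_divisor_def)
    moreover have "size (edges_in T V) < card V" using T(3) F(3) by (simp add: forest_def)
    ultimately show ?thesis by (simp add: genus_def flip: of_nat_sum)
  qed
  ultimately show ?thesis by (simp add: break_divisors_def)
qed

section \<open>Top components of vanishing polynomials\<close>

abbreviation at_divisor :: "('n::finite \<Rightarrow> nat) \<Rightarrow> 'n rpoly \<Rightarrow> rat" where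
  "at_divisor D \<equiv> poly_eval (\<lambda>i. of_nat (D i))"

text \<open>
  Each edge \<open>{i, j}\<close> of \<open>Y\<close> contributes the difference operator \<open>shift i - shift j\<close>. Its leading part is
  \<open>\<partial>\<^sub>i - \<partial>\<^sub>j\<close>, which is adjoint to the factor \<open>x\<^sub>i - x\<^sub>j\<close> of \<open>p\<^sub>Y\<close>; the remainder has too small a degree
  to pair with the other factors. The divisor \<open>D\<^sub>0\<close> for \<open>M\<close> starts the induction: with no edges left to
  choose, \<open>f\<close> is a constant that vanishes at \<open>D\<^sub>0\<close>.
\<close>

lemma pairing_p_poly_endpoint_divisors:
  assumes "loopless Y" "endpoint_divisor M D\<^sub>0" "degree_less (Suc (size Y)) f"
    "\<And>D. endpoint_divisor (M + Y) D \<Longrightarrow> at_divisor D f = 0"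
  shows "pairing (p_poly Y) f = 0"
  using assms(1,3,4)
proof (induction Y arbitrary: f)
  case empty
  have "f = PConst (Poly_Mapping.lookup f 0)"
    using empty(2) by (intro poly_mapping_eqI)
      (auto simp: PConst_def lookup_single when_def degree_less_def Suc_le_eq)
  moreover have "at_divisor D\<^sub>0 f = 0" using assms(2) empty(3) by simp
  ultimately have "f = 0" by (metis poly_eval_simps(3) PConst_0)
  then show ?case by simp
next
  case (add e Y)
  let ?k = "size Y"
  define i j where "i = Min e" and "j = Max e"
  have "e = {i, j}" using card_2_Min_Max(1) add.prems(1) by (auto simp: loopless_def i_def j_def)
  then have ij: "i \<in> e" "j \<in> e" by auto
  have hom: "homogeneous ?k (p_poly Y)" by (rule homogeneous_p_poly)
  have f: "degree_less (Suc (Suc ?k)) f" using add.prems(2) by simp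
  define R where "R v = shift v f - f - partial v f" for v
  have R: "degree_less ?k (R v)" for v using shift_Taylor[OF f] by (simp add: R_def)
  let ?g = "shift i f - shift j f"
  have g: "?g = (R i - R j) + (partial i f - partial j f)" by (simp add: R_def)
  have "pairing (p_poly Y) ?g = 0"
  proof (rule add.IH)
    show "loopless Y" using add.prems(1) by (simp add: loopless_def)
    show "degree_less (Suc ?k) ?g"
      unfolding g by (intro degree_less_linear partial_degree_less f degree_less_mono[OF R]) simp_all
    fix D assume D: "endpoint_divisor (M + Y) D"
    have "at_divisor D (shift v f) = 0" if "v \<in> e" for v
    proof -
      have "at_divisor (D(v := Suc (D v))) f = 0"
        using endpoint_divisor_add[OF D that] by (intro add.prems(3)) (simp del: fun_upd_apply)
      moreover have "(\<lambda>i. of_nat ((D(v := Suc (D v))) i)) = (\<lambda>k. of_nat (D k) + (if k = v then 1 else 0 :: rat))"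
        by auto
      ultimately show ?thesis by (simp only: poly_eval_shift)
    qed
    then show "at_divisor D ?g = 0" using ij by simp
  qed
  then have "pairing (p_poly Y) (partial i f - partial j f) = 0"
    unfolding g using pairing_degree_less[OF hom R]
    by (simp add: pairing_add_right pairing_diff_right)
  moreover have "p_poly (add_mset e Y) = PVar i * p_poly Y - PVar j * p_poly Y"
    by (simp add: p_poly_def i_def j_def left_diff_distrib)
  ultimately show ?case by (simp add: pairing_diff_left pairing_diff_right pairing_PVar_mult)
qed

lemma pairing_slim_vanishing:
  assumes E: "loopless E" "slim E Y" and f: "f \<in> vanishing_ideal E" "degree_less (Suc (size Y)) f"
  shows "pairing (p_poly Y) f = 0"
proof -
  have Y: "Y \<subseteq># E" "connected_graph UNIV (E - Y)" using E(2) by (simp_all add: slim_def)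
  have "loopless (E - Y)" by (rule loopless_subset[OF E(1)]) simp
  then obtain T where T: "T \<subseteq># E - Y" "Suc (size T) = card (UNIV :: 'a set)" "forest T"
    using spanning_tree_ex Y(2) by blast
  have TE: "T \<subseteq># E" using T(1) diff_subset_eq_self subset_mset.order_trans by blast
  have "Y \<subseteq># E - T" using T(1) Y(1) by (metis subset_mset.le_diff_conv2 TE add.commute)
  then have M: "(E - T - Y) + Y = E - T" by (rule subset_mset.diff_add)
  have "loopless (E - T - Y)" by (rule loopless_subset[OF E(1)]) (meson diff_subset_eq_self subset_mset.order_trans)
  then obtain D\<^sub>0 where D0: "endpoint_divisor (E - T - Y) D\<^sub>0" using endpoint_divisor_ex by blast
  have "at_divisor D f = 0" if "endpoint_divisor ((E - T - Y) + Y) D" for D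
    using endpoint_divisor_break[OF TE T(2,3)] that f(1) unfolding M vanishing_ideal_def by blast
  then show ?thesis
    using pairing_p_poly_endpoint_divisors[OF loopless_subset[OF E(1) Y(1)] D0 f(2)] by blast
qed

lemma T_ideal_subset_power_ideal:
  fixes E :: "'n::{finite, linorder} set multiset"
  assumes E: "loopless E" "connected_graph UNIV E"
  shows "T_ideal E \<subseteq> power_ideal E"
proof -
  have "top_component f \<in> power_ideal E" if f: "f \<in> vanishing_ideal E" "f \<noteq> 0" for f
  proof -
    let ?t = "top_component f"
    have "pairing ?t p = 0" if "p \<in> slim_space E" for p
      using that unfolding slim_space_def rat_span_def
    proof (induction rule: Q.span_induct_alt)
      case (step c x y)
      then obtain Y where Y: "x = p_poly Y" "slim E Y" by blast
      have "pairing (p_poly Y) ?t = 0"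
      proof (cases "size Y = total_degree f")
        case True
        then have "pairing (p_poly Y) f = 0"
          using pairing_slim_vanishing[OF E(1) Y(2) f(1)] top_component_split(3)[OF f(2)] by simp
        then show ?thesis using pairing_homogeneous[OF homogeneous_p_poly[of Y], of f] True
          by (simp add: top_component_def)
      next
        case False
        then show ?thesis
          using pairing_homogeneous_neq[OF homogeneous_p_poly top_component_split(1)[OF f(2)]] by blast
      qed
      then show ?case using step Y(1) by (simp add: pairing_add_right pairing_commute)
    qed simp
    then show ?thesis by (simp add: power_ideal_eq_orthogonal[OF E])
  qed
  then show ?thesis
    unfolding T_ideal_def power_ideal_def by (intro ideal_gen_subset) auto
qed

section \<open>Bonds\<close>

text \<open>
  A component of one side has its cut contained in the bond; by minimality it has the same cut, so no
  edges leave the rest of that side.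
\<close>

lemma bond_side_connected:
  assumes E: "loopless E" "connected_graph UNIV E" and S: "S \<noteq> {}" "S \<noteq> UNIV" and b: "is_bond E (cut E S)"
  shows "connected_graph S (edges_in E S)"
proof -
  have "S \<subseteq> {v. (u, v) \<in> {(a, b). {a, b} \<in># edges_in E S}\<^sup>*}" if u: "u \<in> S" for u
  proof (rule ccontr)
    define A where "A = {v. (u, v) \<in> {(a, b). {a, b} \<in># edges_in E S}\<^sup>*}"
    assume "\<not> S \<subseteq> {v. (u, v) \<in> {(a, b). {a, b} \<in># edges_in E S}\<^sup>*}"
    then have nsub: "\<not> S \<subseteq> A" by (simp add: A_def)
    have AS: "A \<subseteq> S"
    proof
      fix v assume "v \<in> A"
      then have "(u, v) \<in> {(a, b). {a, b} \<in># edges_in E S}\<^sup>*" by (simp add: A_def)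
      then show "v \<in> S" by (induction rule: rtrancl_induct) (use u in \<open>auto simp: edges_in_def\<close>)
    qed
    have uA: "u \<in> A" by (simp add: A_def)
    have closed: "y \<in> A" if "x \<in> A" "y \<in> S" "{x, y} \<in># E" for x y
    proof -
      have "{x, y} \<in># edges_in E S" using that AS by (auto simp: edges_in_def)
      then show ?thesis using that(1) unfolding A_def by (auto intro: rtrancl_into_rtrancl)
    qed
    have sub: "cut E A \<subseteq># cut E S"
      unfolding cut_def
    proof (rule filter_mset_mono_strong)
      fix e assume e: "e \<in># E" "e \<inter> A \<noteq> {} \<and> e \<inter> - A \<noteq> {}"
      obtain a b where "e = {a, b}" using loopless_edgeE[OF E(1) e(1)] by blast
      then obtain x y where xy: "e = {x, y}" "x \<in> A" "y \<notin> A" using e(2) by auto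
      then have "y \<notin> S" using closed e(1) by blast
      then show "e \<inter> S \<noteq> {} \<and> e \<inter> - S \<noteq> {}" using xy AS by auto
    qed simp
    have A: "A \<noteq> {}" "A \<noteq> UNIV" using uA AS S by auto
    have "\<forall>T. T \<noteq> {} \<and> T \<noteq> UNIV \<and> cut E T \<noteq> {#} \<and> cut E T \<subseteq># cut E S \<longrightarrow> cut E T = cut E S"
      using b unfolding is_bond_def by (elim conjE)
    from this[rule_format, OF conjI, OF A(1) conjI, OF A(2) conjI, OF connected_graph_UNIV_cut[OF E(2) A] sub]
    have "cut E A = cut E S" .
    moreover have "S \<inter> A = A" using AS by blast
    ultimately have "cut E S = cut E S + cut E (S - A)" using cut_split[OF E(1) sub] by simp
    then have "cut E (S - A) = {#}" by simp
    moreover have "S - A \<noteq> {}" "S - A \<noteq> UNIV" using nsub S by auto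
    ultimately show False using connected_graph_UNIV_cut[OF E(2), of "S - A"] by simp
  qed
  then show ?thesis using S(1) unfolding connected_graph_def by blast
qed

text \<open>
  The lower bound is the genus of the side \<open>S\<close>, the upper bound comes from the genus of the other side;
  the genera of the two sides fall short of the total genus by \<open>d(S) - 1\<close>.
\<close>

lemma break_divisor_bond:
  assumes E: "loopless E" "connected_graph UNIV E" and S: "S \<noteq> {}" "S \<noteq> UNIV" and b: "is_bond E (cut E S)"
    and D: "D \<in> break_divisors E"
  shows "\<exists>j<size (cut E S). (\<Sum>v\<in>S. int (D v)) = genus S (edges_in E S) + int j"
proof -
  have bound: "genus U (edges_in E U) \<le> (\<Sum>v\<in>U. int (D v))"
    if "U \<noteq> {}" "U \<noteq> UNIV" "is_bond E (cut E U)" for U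
  proof -
    have "connected_subgraph E U (edges_in E U)"
      using bond_side_connected[OF E that] by (auto simp: connected_subgraph_def edges_in_def)
    then show ?thesis using D by (simp add: break_divisors_def)
  qed
  have total: "(\<Sum>v\<in>S. int (D v)) + (\<Sum>v\<in>- S. int (D v)) = genus UNIV E"
    using D sum.union_disjoint[of S "- S" "\<lambda>v. int (D v)"] by (simp add: break_divisors_def)
  have "size E = size (edges_in E S) + size (edges_in E (- S)) + size (cut E S)"
  proof -
    have "E = edges_in E S + edges_in E (- S) + cut E S"
    proof (rule multiset_eqI)
      fix e
      show "count E e = count (edges_in E S + edges_in E (- S) + cut E S) e"
      proof (cases "e \<in># E")
        case True
        then obtain a b where e: "e = {a, b}" using loopless_edgeE[OF E(1)] by blast
        then show ?thesis by (cases "a \<in> S"; cases "b \<in> S") (simp_all add: edges_in_def cut_def)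
      next
        case False
        then show ?thesis by (simp add: edges_in_def cut_def not_in_iff)
      qed
    qed
    then show ?thesis by (metis size_union)
  qed
  moreover have "card (UNIV :: 'a set) = card S + card (- S)"
    using card_Un_disjoint[of S "- S"] by simp
  moreover have "genus S (edges_in E S) \<le> (\<Sum>v\<in>S. int (D v))" by (rule bound[OF S b])
  moreover have "genus (- S) (edges_in E (- S)) \<le> (\<Sum>v\<in>- S. int (D v))"
    by (rule bound) (use S b in \<open>auto simp: cut_Compl\<close>)
  ultimately have "genus S (edges_in E S) \<le> (\<Sum>v\<in>S. int (D v))"
    "(\<Sum>v\<in>S. int (D v)) < genus S (edges_in E S) + int (size (cut E S))"
    using total by (simp_all add: genus_def)
  then show ?thesis by (intro exI[of _ "nat ((\<Sum>v\<in>S. int (D v)) - genus S (edges_in E S))"]) auto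
qed

lemma degree_less_PConst_mult: "degree_less k f \<Longrightarrow> degree_less k (PConst c * f)"
  using degree_less_linear(4)[of k f c] by (simp add: pscale_def)

lemma prod_shifted_leading:
  assumes "homogeneous 1 x"
  shows "degree_less d ((\<Prod>j<d. x - PConst (c j)) - x ^ d)"
proof (induction d)
  case (Suc d)
  let ?q = "\<Prod>j<d. x - PConst (c j)"
  have x: "degree_less (Suc 1) x" by (rule degree_less_homogeneous[OF assms]) simp
  have "degree_less (Suc d) (x * (?q - x ^ d))" using degree_less_mult[OF x Suc] by simp
  moreover have "degree_less (Suc d) ((?q - x ^ d) + x ^ d)"
    using degree_less_mono[OF Suc, of "Suc d"] homogeneous_power[OF assms, of d]
    by (intro degree_less_linear(2)) (auto intro: degree_less_homogeneous)
  then have "degree_less (Suc d) (PConst (c d) * ?q)" by (simp add: degree_less_PConst_mult)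
  ultimately have "degree_less (Suc d) (x * (?q - x ^ d) - PConst (c d) * ?q)" by (rule degree_less_linear)
  then show ?case by (simp add: algebra_simps)
qed simp

definition power_gens :: "'n::finite set multiset \<Rightarrow> 'n rpoly set" where
  "power_gens E = insert (xsum UNIV)
     {xsum S ^ size (cut E S) | S. S \<noteq> {} \<and> S \<noteq> UNIV \<and> is_bond E (cut E S)}"

lemma power_ideal_gens: "power_ideal E = ideal_gen (power_gens E)"
  by (simp add: power_ideal_def power_gens_def)

text \<open>
  Every generator of the power ideal is, up to terms of lower degree, a polynomial that vanishes on the
  break divisors.
\<close>

lemma power_gens_lift:
  assumes E: "loopless E" "connected_graph UNIV E" and g: "g \<in> power_gens E"
  obtains k v where "homogeneous k g" "v \<in> vanishing_ideal E" "degree_less k (v - g)"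
proof -
  consider "g = xsum UNIV" | S where "g = xsum S ^ size (cut E S)" "S \<noteq> {}" "S \<noteq> UNIV" "is_bond E (cut E S)"
    using g unfolding power_gens_def by blast
  then show ?thesis
  proof cases
    case 1
    let ?c = "of_int (genus UNIV E) :: rat"
    have "xsum UNIV - PConst ?c - g = - PConst ?c" by (simp add: 1)
    then have "degree_less 1 (xsum UNIV - PConst ?c - g)"
      unfolding PConst_uminus[symmetric] degree_less_keys by (simp add: PConst_def del: single_of_int)
    moreover have "xsum UNIV - PConst ?c \<in> vanishing_ideal E"
    proof -
      have "(\<Sum>v\<in>UNIV. of_nat (D v)) = ?c" if "D \<in> break_divisors E" for D
      proof -
        have "(\<Sum>v\<in>UNIV. int (D v)) = genus UNIV E" using that by (simp add: break_divisors_def)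
        from arg_cong[OF this, of "of_int :: int \<Rightarrow> rat"] show ?thesis by simp
      qed
      then show ?thesis by (simp add: vanishing_ideal_def)
    qed
    ultimately show ?thesis using that homogeneous_xsum 1 by blast
  next
    case (2 S)
    let ?d = "size (cut E S)"
    define c where "c j = (of_int (genus S (edges_in E S)) + of_nat j :: rat)" for j
    let ?v = "\<Prod>j<?d. xsum S - PConst (c j)"
    have "at_divisor D ?v = 0" if "D \<in> break_divisors E" for D
    proof -
      obtain j where j: "j < ?d" "(\<Sum>v\<in>S. int (D v)) = genus S (edges_in E S) + int j"
        using break_divisor_bond[OF E 2(2-4) \<open>D \<in> break_divisors E\<close>] by blast
      from arg_cong[OF j(2), of "of_int :: int \<Rightarrow> rat"] have "(\<Sum>v\<in>S. of_nat (D v)) = c j"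
        by (simp add: c_def)
      then show ?thesis using j(1) by (auto simp: prod_zero_iff)
    qed
    then have "?v \<in> vanishing_ideal E" by (simp add: vanishing_ideal_def)
    moreover have "degree_less ?d (?v - g)" unfolding 2(1) by (rule prod_shifted_leading[OF homogeneous_xsum])
    moreover have "homogeneous ?d g" using homogeneous_power[OF homogeneous_xsum[of S], of ?d] 2(1) by simp
    ultimately show ?thesis using that by blast
  qed
qed

theorem T_ideal_eq_power_ideal:
  fixes E :: "'n::{finite, linorder} set multiset"
  assumes E: "loopless E" "connected_graph UNIV E"
  shows "T_ideal E = power_ideal E"
proof
  have "g \<in> T_ideal E" if g: "g \<in> power_gens E" for g
  proof (cases "g = 0")
    case True
    then show ?thesis by (simp add: T_ideal_def ideal_gen_0)
  next
    case False
    obtain k v where "homogeneous k g" "v \<in> vanishing_ideal E" "degree_less k (v - g)"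
      using power_gens_lift[OF E g] by blast
    then have "v \<noteq> 0" "top_component v = g" "v \<in> vanishing_ideal E"
      using top_component_eq[of k g v] False by simp_all
    then show ?thesis unfolding T_ideal_def by (intro ideal_gen_base) blast
  qed
  then show "power_ideal E \<subseteq> T_ideal E"
    unfolding power_ideal_gens T_ideal_def by (intro ideal_gen_subset subsetI)
qed (rule T_ideal_subset_power_ideal[OF E])

section \<open>Evaluation at the break divisors\<close>

lemma vanishing_ideal_closed:
  "0 \<in> vanishing_ideal E"
  "f \<in> vanishing_ideal E \<Longrightarrow> g \<in> vanishing_ideal E \<Longrightarrow> f + g \<in> vanishing_ideal E"
  "f \<in> vanishing_ideal E \<Longrightarrow> h * f \<in> vanishing_ideal E"
  by (simp_all add: vanishing_ideal_def)

text \<open>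
  The top component of a counterexample would be slim and lie in \<open>T = I\<close>, hence be orthogonal to itself.
\<close>

lemma slim_space_Int_vanishing_ideal:
  assumes E: "loopless E" "connected_graph UNIV E" and p: "p \<in> slim_space E" "p \<in> vanishing_ideal E"
  shows "p = 0"
proof (rule ccontr)
  assume nz: "p \<noteq> 0"
  have "top_component p \<in> T_ideal E" unfolding T_ideal_def using p(2) nz by (intro ideal_gen_base) blast
  moreover have "top_component p \<in> slim_space E"
    unfolding top_component_def by (rule hcomponent_slim_space[OF p(1)])
  ultimately have "top_component p = 0"
    using slim_space_Int_power_ideal[OF E] T_ideal_eq_power_ideal[OF E] by blast
  then show False using top_component_split(2)[OF nz] by simp
qed

text \<open>
  Replace the generators in a representation of \<open>u\<close> by their vanishing lifts; only terms below degree \<open>d\<close>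
  change.
\<close>

lemma power_ideal_lift:
  assumes E: "loopless E" "connected_graph UNIV E" and u: "u \<in> power_ideal E"
  shows "\<exists>v\<in>vanishing_ideal E. degree_less d (hcomponent d u - v)"
  using u unfolding power_ideal_gens
proof (induction rule: ideal_gen_induct)
  case zero
  show ?case by (intro bexI[of _ 0]) (simp_all add: vanishing_ideal_closed degree_less_linear)
next
  case (step h g f)
  obtain w where w: "w \<in> vanishing_ideal E" "degree_less d (hcomponent d f - w)" using step.IH by blast
  obtain k v where v: "homogeneous k g" "v \<in> vanishing_ideal E" "degree_less k (v - g)"
    using power_gens_lift[OF E step(1)] by blast
  show ?case
  proof (cases "k \<le> d")
    case True
    let ?h = "hcomponent (d - k) h"
    have "degree_less (d - k + k) (?h * (v - g))"
      by (rule degree_less_mult[OF degree_less_homogeneous v(3)]) (rule homogeneous_hcomponent, simp)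
    then have "degree_less d ((hcomponent d f - w) - ?h * (v - g))"
      using True degree_less_linear(3)[OF w(2)] by simp
    also have "(hcomponent d f - w) - ?h * (v - g) = hcomponent d (h * g + f) - (?h * v + w)"
      using True by (simp add: hcomponent_mult_homogeneous[OF v(1)] right_diff_distrib)
    finally show ?thesis using vanishing_ideal_closed w(1) v(2) by blast
  next
    case False
    then show ?thesis using w by (simp add: hcomponent_mult_homogeneous[OF v(1)]) blast
  qed
qed

text \<open>
  In the top degree, split into a slim part and a part in the power ideal, and lift the latter to a
  vanishing polynomial. What remains has smaller degree.
\<close>

lemma slim_space_vanishing_ideal_decomposition:
  assumes E: "loopless E" "connected_graph UNIV E"
  shows "\<exists>p\<in>slim_space E. f - p \<in> vanishing_ideal E"
proof -
  have add: "p + q \<in> slim_space E" if "p \<in> slim_space E" "q \<in> slim_space E" for p q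
    using that unfolding slim_space_def rat_span_def by (rule Q.span_add)
  obtain N where "degree_less N f" using degree_less_ex by blast
  then show ?thesis
  proof (induction N arbitrary: f)
    case 0
    have "0 \<in> slim_space E" unfolding slim_space_def rat_span_def by (rule Q.span_zero)
    then show ?case using 0 vanishing_ideal_closed(1) by (intro bexI[of _ 0]) simp_all
  next
    case (Suc N)
    obtain p where p: "p \<in> slim_space E" "hcomponent N f - p \<in> power_ideal E"
      using slim_space_power_ideal_decomposition[OF E] by blast
    obtain v where v: "v \<in> vanishing_ideal E" "degree_less N (hcomponent N (hcomponent N f - p) - v)"
      using power_ideal_lift[OF E p(2)] by blast
    let ?p = "hcomponent N p"
    have "degree_less N ((f - hcomponent N f) + (hcomponent N (hcomponent N f - p) - v))"
      by (rule degree_less_linear(2)[OF degree_less_hcomponent[OF Suc.prems] v(2)])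
    moreover have "hcomponent N (hcomponent N f) = hcomponent N f"
      by (rule poly_mapping_eqI) simp
    ultimately have "degree_less N (f - ?p - v)" by (simp add: algebra_simps)
    then obtain q where q: "q \<in> slim_space E" "f - ?p - v - q \<in> vanishing_ideal E" using Suc.IH by blast
    have "(f - ?p - v - q) + v \<in> vanishing_ideal E" using vanishing_ideal_closed(2) q(2) v(1) by blast
    then have "f - (?p + q) \<in> vanishing_ideal E" by (simp add: algebra_simps)
    moreover have "?p + q \<in> slim_space E" using add hcomponent_slim_space p(1) q(1) by blast
    ultimately show ?case by blast
  qed
qed

lemma finite_break_divisors: "finite (break_divisors E)"
proof -
  have "D v \<le> nat (genus UNIV E)" if "D \<in> break_divisors E" for D v
  proof -
    have "int (D v) \<le> (\<Sum>v\<in>UNIV. int (D v))" by (rule member_le_sum) auto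
    then show ?thesis using that by (simp add: break_divisors_def)
  qed
  then have "break_divisors E \<subseteq> PiE UNIV (\<lambda>_. {..nat (genus UNIV E)})" by (auto simp: PiE_def)
  then show ?thesis by (rule finite_subset) (auto intro: finite_PiE)
qed

text \<open>
  Lagrange interpolation; \<open>i D'\<close> is a coordinate in which \<open>D'\<close> differs from \<open>D\<close>.
\<close>

lemma interpolation:
  assumes "finite B"
  shows "\<exists>f. \<forall>D\<in>B. at_divisor D f = a D"
proof -
  have "\<exists>f. at_divisor D f = 1 \<and> (\<forall>D'\<in>B. D' \<noteq> D \<longrightarrow> at_divisor D' f = 0)" for D
  proof -
    have "\<forall>D'. \<exists>i. D' \<noteq> D \<longrightarrow> D' i \<noteq> D i" by auto
    then obtain i where i: "D' \<noteq> D \<Longrightarrow> D' (i D') \<noteq> D (i D')" for D' by metis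
    let ?l = "\<lambda>D'. pscale (1 / (of_nat (D (i D')) - of_nat (D' (i D')))) (PVar (i D') - PConst (of_nat (D' (i D'))))"
    let ?f = "\<Prod>D'\<in>B - {D}. ?l D'"
    have "at_divisor D (?l D') = 1" if "D' \<noteq> D" for D' using i[OF that] by simp
    then have "at_divisor D ?f = 1" by (simp del: poly_eval_more)
    moreover have "at_divisor D' ?f = 0" if "D' \<in> B" "D' \<noteq> D" for D'
      using that assms by (auto intro!: bexI[of _ D'])
    ultimately show ?thesis by blast
  qed
  then obtain \<delta> where \<delta>: "at_divisor D (\<delta> D) = 1" "D' \<in> B \<Longrightarrow> D' \<noteq> D \<Longrightarrow> at_divisor D' (\<delta> D) = 0" for D D'
    by metis
  have "at_divisor D' (\<Sum>D\<in>B. pscale (a D) (\<delta> D)) = a D'" if "D' \<in> B" for D'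
  proof -
    have "at_divisor D' (\<Sum>D\<in>B. pscale (a D) (\<delta> D)) = (\<Sum>D\<in>B. if D' = D then a D else 0)"
      using \<delta> that by (auto intro!: sum.cong)
    then show ?thesis using that assms by simp
  qed
  then show ?thesis by blast
qed

section \<open>Automorphisms\<close>

lemma AutD:
  assumes "\<sigma> \<in> Aut E"
  shows "bij \<sigma>" "inj \<sigma>" "\<sigma> permutes UNIV"
  using assms by (auto simp: Aut_def intro: permutes_bij permutes_inj)

lemma inv_Aut:
  assumes "\<sigma> \<in> Aut E"
  shows "inv \<sigma> \<in> Aut E"
proof -
  have "count E {inv \<sigma> i, inv \<sigma> j} = count E {i, j}" for i j
  proof -
    have "count E {\<sigma> (inv \<sigma> i), \<sigma> (inv \<sigma> j)} = count E {inv \<sigma> i, inv \<sigma> j}"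
      using assms unfolding Aut_def by blast
    then show ?thesis using AutD[OF assms] by (simp add: permutes_inverses)
  qed
  then show ?thesis using AutD(3)[OF assms] by (simp add: Aut_def permutes_inv)
qed

lemma Aut_comp_inv:
  assumes "\<sigma> \<in> Aut E"
  shows "\<sigma> \<circ> inv \<sigma> = id" "inv \<sigma> \<circ> \<sigma> = id"
  using AutD(3)[OF assms] by (rule permutes_inv_o)+

lemma count_image_mset_inj:
  assumes "inj f"
  shows "count (image_mset f A) (f x) = count A x"
  using assms by (induction A) (auto simp: inj_eq)

text \<open>
  The definition of automorphisms counts edges between pairs of vertices; the loopless edge multiset
  has no other elements.
\<close>

lemma Aut_image_edges:
  assumes E: "loopless E" and \<sigma>: "\<sigma> \<in> Aut E"
  shows "image_mset (image \<sigma>) E = E"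
proof (rule multiset_eqI)
  fix e
  define e' where "e' = inv \<sigma> ` e"
  have e: "e = \<sigma> ` e'" using Aut_comp_inv(1)[OF \<sigma>] by (simp add: e'_def image_comp)
  have inj: "inj (image \<sigma>)" using AutD(2)[OF \<sigma>] by (simp add: inj_image_eq_iff inj_def)
  have "count (image_mset (image \<sigma>) E) e = count E e'"
    unfolding e using inj by (simp add: count_image_mset_inj)
  also have "\<dots> = count E e"
  proof (cases "card e = 2")
    case True
    then have "card e' = 2" unfolding e using AutD(2)[OF \<sigma>] by (simp add: card_image inj_on_subset)
    then obtain i j where "e' = {i, j}" by (meson card_2_iff)
    then show ?thesis using \<sigma> by (simp add: e Aut_def)
  next
    case False
    then have "card e' \<noteq> 2" unfolding e using AutD(2)[OF \<sigma>] by (simp add: card_image inj_on_subset)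
    then have "e \<notin># E" "e' \<notin># E" using E False by (auto simp: loopless_def)
    then show ?thesis by (simp add: not_in_iff)
  qed
  finally show "count (image_mset (image \<sigma>) E) e = count E e" .
qed

lemma Aut_cut:
  assumes E: "loopless E" and \<sigma>: "\<sigma> \<in> Aut E"
  shows "cut E (\<sigma> ` S) = image_mset (image \<sigma>) (cut E S)"
proof -
  have "\<sigma> ` e \<inter> \<sigma> ` S \<noteq> {} \<and> \<sigma> ` e \<inter> - \<sigma> ` S \<noteq> {} \<longleftrightarrow> e \<inter> S \<noteq> {} \<and> e \<inter> - S \<noteq> {}" for e
    by (simp add: bij_image_Compl_eq[OF AutD(1)[OF \<sigma>], symmetric] image_Int[OF AutD(2)[OF \<sigma>], symmetric])
  then have "cut (image_mset (image \<sigma>) E) (\<sigma> ` S) = image_mset (image \<sigma>) (cut E S)"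
    by (simp add: cut_def filter_mset_image_mset)
  then show ?thesis by (simp only: Aut_image_edges[OF E \<sigma>])
qed

text \<open>
  Since the powers for all cuts belong to the ideal, it is enough that automorphisms preserve cut sizes.
\<close>

lemma permute_vars_power_ideal:
  assumes E: "loopless E" "connected_graph UNIV E" and \<sigma>: "\<sigma> \<in> Aut E"
  shows "permute_vars \<sigma> ` power_ideal E = power_ideal E"
proof -
  have sub: "permute_vars \<tau> f \<in> power_ideal E" if \<tau>: "\<tau> \<in> Aut E" and f: "f \<in> power_ideal E" for \<tau> f
    using f unfolding power_ideal_gens
  proof (induction rule: ideal_gen_induct)
    case zero
    then show ?case by (simp add: ideal_gen_0)
  next
    case (step h g f)
    have "permute_vars \<tau> g \<in> power_ideal E"
    proof (cases "g = xsum UNIV")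
      case True
      then show ?thesis using AutD(1,2)[OF \<tau>]
        by (simp add: permute_vars_xsum bij_is_surj power_ideal_gens power_gens_def ideal_gen_base)
    next
      case False
      then obtain S where S: "g = xsum S ^ size (cut E S)" "S \<noteq> {}" "S \<noteq> UNIV"
        using step(1) unfolding power_gens_def by blast
      have "\<tau> ` S \<noteq> UNIV" using S(3) AutD(1)[OF \<tau>] by (metis bij_is_inj bij_is_surj inj_image_eq_iff)
      then have "xsum (\<tau> ` S) ^ size (cut E (\<tau> ` S)) \<in> power_ideal E"
        using S(2) by (intro xsum_power_in_power_ideal[OF E]) auto
      then show ?thesis using S(1) AutD(2)[OF \<tau>] by (simp add: permute_vars_xsum Aut_cut[OF E(1) \<tau>])
    qed
    then show ?case using step.IH by (simp add: power_ideal_gens ideal_gen_add ideal_gen_mult)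
  qed
  have "f \<in> permute_vars \<sigma> ` power_ideal E" if "f \<in> power_ideal E" for f
    using sub[OF inv_Aut[OF \<sigma>] that] permute_vars_comp[of \<sigma> "inv \<sigma>" f] Aut_comp_inv(1)[OF \<sigma>]
    by (intro image_eqI[of _ _ "permute_vars (inv \<sigma>) f"]) simp_all
  then show ?thesis using sub[OF \<sigma>] by blast
qed

text \<open>
  An automorphism may reverse the orientation of edges, which changes \<open>p\<^sub>Y\<close> by a sign.
\<close>

lemma permute_vars_p_poly:
  assumes "loopless Y" "inj \<sigma>"
  shows "permute_vars \<sigma> (p_poly Y) = p_poly (image_mset (image \<sigma>) Y) \<or>
    permute_vars \<sigma> (p_poly Y) = - p_poly (image_mset (image \<sigma>) Y)"
  using assms(1)
proof (induction Y)
  case empty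
  show ?case by (simp add: p_poly_def)
next
  case (add e Y)
  obtain a b where ab: "Min e = a" "Max e = b" by simp
  obtain c d where cd: "Min (\<sigma> ` e) = c" "Max (\<sigma> ` e) = d" by simp
  have c2: "card e = 2" using add.prems by (simp add: loopless_def)
  then have "card (\<sigma> ` e) = 2" using assms(2) by (simp add: card_image inj_on_subset)
  then have "\<sigma> ` e = {c, d}" using card_2_Min_Max(1)[of "\<sigma> ` e"] cd by simp
  moreover have "e = {a, b}" "a \<noteq> b" using card_2_Min_Max[OF c2] ab by simp_all
  ultimately have "\<sigma> a = c \<and> \<sigma> b = d \<or> \<sigma> a = d \<and> \<sigma> b = c"
    by (auto simp: doubleton_eq_iff)
  then have edge: "PVar (\<sigma> a) - PVar (\<sigma> b) = PVar c - PVar d \<or> PVar (\<sigma> a) - PVar (\<sigma> b) = - (PVar c - PVar d)"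
    by auto
  have l: "p_poly (add_mset e Y) = (PVar a - PVar b) * p_poly Y"
    "p_poly (image_mset (image \<sigma>) (add_mset e Y)) = (PVar c - PVar d) * p_poly (image_mset (image \<sigma>) Y)"
    by (simp_all add: p_poly_def ab cd)
  have "loopless Y" using add.prems by (simp add: loopless_def)
  from add.IH[OF this] edge show ?case
    unfolding l permute_vars_simps permute_vars_more by (elim disjE) (simp_all only: minus_mult_minus mult_minus_left mult_minus_right minus_minus simp_thms)
qed

lemma slim_image:
  assumes E: "loopless E" "connected_graph UNIV E" and \<sigma>: "\<sigma> \<in> Aut E" and Y: "slim E Y"
  shows "slim E (image_mset (image \<sigma>) Y)"
  unfolding slim_iff_no_cut[OF E]
proof (intro conjI allI impI notI)
  have Y': "Y \<subseteq># E" "\<And>S. cut E S \<noteq> {#} \<Longrightarrow> \<not> cut E S \<subseteq># Y"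
    using Y unfolding slim_iff_no_cut[OF E] by auto
  show "image_mset (image \<sigma>) Y \<subseteq># E"
    using image_mset_subseteq_mono[OF Y'(1), of "image \<sigma>"] by (simp only: Aut_image_edges[OF E(1) \<sigma>])
  fix S assume S: "cut E S \<noteq> {#}" "cut E S \<subseteq># image_mset (image \<sigma>) Y"
  have inv: "image_mset (image (inv \<sigma>)) (image_mset (image \<sigma>) Z) = Z" for Z
    using Aut_comp_inv(2)[OF \<sigma>] by (simp add: multiset.map_comp comp_def image_comp)
  have "cut E (inv \<sigma> ` S) = image_mset (image (inv \<sigma>)) (cut E S)"
    by (rule Aut_cut[OF E(1) inv_Aut[OF \<sigma>]])
  moreover have "image_mset (image (inv \<sigma>)) (cut E S) \<subseteq># Y"
    using image_mset_subseteq_mono[OF S(2), of "image (inv \<sigma>)"] by (simp only: inv)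
  ultimately show False using Y'(2)[of "inv \<sigma> ` S"] S(1) by simp
qed

lemma permute_vars_slim_space:
  assumes E: "loopless E" "connected_graph UNIV E" and \<sigma>: "\<sigma> \<in> Aut E" and p: "p \<in> slim_space E"
  shows "permute_vars \<sigma> p \<in> slim_space E"
  using p unfolding slim_space_def rat_span_def
proof (induction rule: Q.span_induct_alt)
  case base
  show ?case by (simp add: Q.span_zero)
next
  case (step c x y)
  then obtain Y where Y: "x = p_poly Y" "slim E Y" by blast
  have "loopless Y" using Y(2) loopless_subset[OF E(1)] by (auto simp: slim_def)
  then have "permute_vars \<sigma> x = p_poly (image_mset (image \<sigma>) Y) \<or> permute_vars \<sigma> x = - p_poly (image_mset (image \<sigma>) Y)"
    unfolding Y(1) by (rule permute_vars_p_poly[OF _ AutD(2)[OF \<sigma>]])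
  moreover have "p_poly (image_mset (image \<sigma>) Y) \<in> Q.span {p_poly Y |Y. slim E Y}"
    using slim_image[OF E \<sigma> Y(2)] by (intro Q.span_base) blast
  ultimately have "permute_vars \<sigma> x \<in> Q.span {p_poly Y |Y. slim E Y}" using Q.span_neg by auto
  then show ?case using step(2) by (simp add: Q.span_add Q.span_scale)
qed

lemma connected_subgraph_image:
  assumes E: "loopless E" and \<sigma>: "\<sigma> \<in> Aut E" and H: "connected_subgraph E V F"
  shows "connected_subgraph E (\<sigma> ` V) (image_mset (image \<sigma>) F)"
  unfolding connected_subgraph_def connected_graph_def
proof (intro conjI)
  show "image_mset (image \<sigma>) F \<subseteq># E"
    using H image_mset_subseteq_mono[of F E "image \<sigma>"]
    by (simp add: Aut_image_edges[OF E \<sigma>] connected_subgraph_def)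
  show "\<forall>e\<in>#image_mset (image \<sigma>) F. e \<subseteq> \<sigma> ` V" "\<sigma> ` V \<noteq> {}"
    using H by (simp_all add: connected_subgraph_def connected_graph_def image_mono)
  have "(\<sigma> u, \<sigma> v) \<in> {(a, b). {a, b} \<in># image_mset (image \<sigma>) F}\<^sup>*"
    if "(u, v) \<in> {(a, b). {a, b} \<in># F}\<^sup>*" for u v
    using that
  proof (induction rule: rtrancl_induct)
    case (step y z)
    then have "{y, z} \<in># F" by simp
    then have "\<sigma> ` {y, z} \<in> image \<sigma> ` set_mset F" by (rule imageI)
    then have "{\<sigma> y, \<sigma> z} \<in># image_mset (image \<sigma>) F" by simp
    then show ?case using step.IH by (auto intro: rtrancl_into_rtrancl)
  qed simp
  then show "\<forall>u\<in>\<sigma> ` V. \<forall>v\<in>\<sigma> ` V. (u, v) \<in> {(a, b). {a, b} \<in># image_mset (image \<sigma>) F}\<^sup>*"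
    using H by (auto simp: connected_subgraph_def connected_graph_def)
qed

lemma break_divisors_comp:
  assumes E: "loopless E" and \<sigma>: "\<sigma> \<in> Aut E" and D: "D \<in> break_divisors E"
  shows "D \<circ> \<sigma> \<in> break_divisors E"
proof -
  have sum: "(\<Sum>v\<in>V. int ((D \<circ> \<sigma>) v)) = (\<Sum>v\<in>\<sigma> ` V. int (D v))" for V
    using AutD(2)[OF \<sigma>] by (simp add: sum.reindex inj_on_subset)
  have "genus V F \<le> (\<Sum>v\<in>V. int ((D \<circ> \<sigma>) v))" if "connected_subgraph E V F" for V F
  proof -
    have "genus (\<sigma> ` V) (image_mset (image \<sigma>) F) \<le> (\<Sum>v\<in>\<sigma> ` V. int (D v))"
      using D connected_subgraph_image[OF E \<sigma> that] by (simp add: break_divisors_def)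
    moreover have "genus (\<sigma> ` V) (image_mset (image \<sigma>) F) = genus V F"
      using AutD(2)[OF \<sigma>] by (simp add: genus_def card_image inj_on_subset)
    ultimately show ?thesis by (simp only: sum)
  qed
  moreover have "\<sigma> ` UNIV = UNIV" using AutD(1)[OF \<sigma>] by (simp add: bij_is_surj)
  ultimately show ?thesis using D unfolding break_divisors_def mem_Collect_eq sum by simp
qed

section \<open>Isomorphisms\<close>

lemma is_gmodule_iso_inverse:
  assumes iso: "is_gmodule_iso \<Gamma> N M \<psi>"
    and closed: "\<And>u v. u \<in> gelems N \<Longrightarrow> v \<in> gelems N \<Longrightarrow> gadd N u v \<in> gelems N"
      "\<And>c u. u \<in> gelems N \<Longrightarrow> gscale N c u \<in> gelems N"
      "\<And>\<sigma> u. \<sigma> \<in> \<Gamma> \<Longrightarrow> u \<in> gelems N \<Longrightarrow> gact N \<sigma> u \<in> gelems N"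
  shows "is_gmodule_iso \<Gamma> M N (inv_into (gelems N) \<psi>)"
proof -
  let ?\<phi> = "inv_into (gelems N) \<psi>"
  have bij: "bij_betw \<psi> (gelems N) (gelems M)" using iso by (simp add: is_gmodule_iso_def)
  then have inv: "?\<phi> x \<in> gelems N" "\<psi> (?\<phi> x) = x" if "x \<in> gelems M" for x
    using that by (auto simp: bij_betw_def inv_into_into f_inv_into_f)
  have eqI: "?\<phi> (\<psi> u) = u" if "u \<in> gelems N" for u
    using bij that by (simp add: bij_betw_def inv_into_f_f)
  show ?thesis
    unfolding is_gmodule_iso_def
  proof (intro conjI ballI allI)
    show "bij_betw ?\<phi> (gelems M) (gelems N)" using bij by (rule bij_betw_inv_into)
    fix u v assume u: "u \<in> gelems M" and v: "v \<in> gelems M"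
    have "\<psi> (gadd N (?\<phi> u) (?\<phi> v)) = gadd M u v"
      using iso inv[OF u] inv[OF v] by (simp add: is_gmodule_iso_def)
    then show "?\<phi> (gadd M u v) = gadd N (?\<phi> u) (?\<phi> v)"
      using eqI[OF closed(1)[OF inv(1)[OF u] inv(1)[OF v]]] by simp
  next
    fix c u assume u: "u \<in> gelems M"
    have "\<psi> (gscale N c (?\<phi> u)) = gscale M c u"
      using iso inv[OF u] by (simp add: is_gmodule_iso_def)
    then show "?\<phi> (gscale M c u) = gscale N c (?\<phi> u)"
      using eqI[OF closed(2)[OF inv(1)[OF u], of c]] by simp
  next
    fix \<sigma> u assume \<sigma>: "\<sigma> \<in> \<Gamma>" and u: "u \<in> gelems M"
    have "\<psi> (gact N \<sigma> (?\<phi> u)) = gact M \<sigma> u"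
      using iso inv[OF u] \<sigma> by (simp add: is_gmodule_iso_def)
    then show "?\<phi> (gact M \<sigma> u) = gact N \<sigma> (?\<phi> u)"
      using eqI[OF closed(3)[OF \<sigma> inv(1)[OF u]]] by simp
  qed
qed

lemma is_gmodule_iso_trans:
  assumes "is_gmodule_iso \<Gamma> M N \<phi>" "is_gmodule_iso \<Gamma> N K \<psi>"
  shows "is_gmodule_iso \<Gamma> M K (\<psi> \<circ> \<phi>)"
proof -
  have "bij_betw (\<psi> \<circ> \<phi>) (gelems M) (gelems K)"
    using assms bij_betw_trans unfolding is_gmodule_iso_def by blast
  moreover have "\<phi> u \<in> gelems N" if "u \<in> gelems M" for u
    using assms(1) that unfolding is_gmodule_iso_def bij_betw_def by blast
  ultimately show ?thesis using assms by (simp add: is_gmodule_iso_def)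
qed

lemma coset_eq_iff:
  "f +o ideal_gen S = g +o ideal_gen S \<longleftrightarrow> f - g \<in> ideal_gen S"
proof
  assume "f +o ideal_gen S = g +o ideal_gen S"
  moreover have "f \<in> f +o ideal_gen S" using ideal_gen_0[of S] by (force simp: elt_set_plus_def)
  ultimately show "f - g \<in> ideal_gen S" by (auto simp: elt_set_plus_def)
next
  assume fg: "f - g \<in> ideal_gen S"
  have "x +o ideal_gen S \<subseteq> y +o ideal_gen S" if "x - y \<in> ideal_gen S" for x y
  proof
    fix z assume "z \<in> x +o ideal_gen S"
    then obtain s where "s \<in> ideal_gen S" "z = x + s" by (auto simp: elt_set_plus_def)
    then have "z = y + ((x - y) + s)" "(x - y) + s \<in> ideal_gen S" using ideal_gen_add[OF that] by auto
    then show "z \<in> y +o ideal_gen S" unfolding elt_set_plus_def by blast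
  qed
  from this[OF fg] this[of g f] show "f +o ideal_gen S = g +o ideal_gen S"
    using ideal_gen_uminus[OF fg] by auto
qed

lemma slim_space_closed:
  "p \<in> slim_space E \<Longrightarrow> q \<in> slim_space E \<Longrightarrow> p + q \<in> slim_space E"
  "p \<in> slim_space E \<Longrightarrow> q \<in> slim_space E \<Longrightarrow> p - q \<in> slim_space E"
  "p \<in> slim_space E \<Longrightarrow> pscale c p \<in> slim_space E"
  unfolding slim_space_def rat_span_def by (rule Q.span_add Q.span_diff Q.span_scale; assumption)+

text \<open>
  The slim space is an \<open>Aut\<close>-stable complement of the power ideal, so it maps isomorphically to the
  quotient. The isomorphisms out of the quotient and out of the permutation module are obtained from
  maps that start at the slim space, which are given by formulas.
\<close>

lemma slim_space_iso_quotient: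
  fixes E :: "'n::{finite, linorder} set multiset"
  assumes E: "loopless E" "connected_graph UNIV E"
  shows "is_gmodule_iso (Aut E) (polynomial_submodule (slim_space E)) (quotient_module (power_ideal E))
    (\<lambda>p. p +o power_ideal E)"
  unfolding is_gmodule_iso_def
proof (intro conjI ballI allI)
  let ?I = "power_ideal E" and ?P = "slim_space E"
  have "inj_on (\<lambda>p. p +o ?I) ?P"
  proof (rule inj_onI)
    fix p q assume "p \<in> ?P" "q \<in> ?P" "p +o ?I = q +o ?I"
    then have "p - q \<in> ?P" "p - q \<in> ?I"
      by (simp_all add: slim_space_closed power_ideal_def coset_eq_iff)
    then show "p = q" using slim_space_Int_power_ideal[OF E] by force
  qed
  moreover have "(\<lambda>p. p +o ?I) ` ?P = {f +o ?I |f. True}"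
  proof -
    have "\<exists>p\<in>?P. f +o ?I = p +o ?I" for f
    proof -
      obtain p where "p \<in> ?P" "f - p \<in> ?I" using slim_space_power_ideal_decomposition[OF E] by blast
      then show ?thesis unfolding power_ideal_def coset_eq_iff by blast
    qed
    then show ?thesis by blast
  qed
  ultimately show "bij_betw (\<lambda>p. p +o ?I) (gelems (polynomial_submodule ?P)) (gelems (quotient_module ?I))"
    by (simp add: bij_betw_def polynomial_submodule_def quotient_module_def)
  fix u v c
  show "gadd (polynomial_submodule ?P) u v +o ?I = gadd (quotient_module ?I) (u +o ?I) (v +o ?I)"
    by (simp add: power_ideal_def quotient_add polynomial_submodule_def)
  show "gscale (polynomial_submodule ?P) c u +o ?I = gscale (quotient_module ?I) c (u +o ?I)"
    by (simp add: power_ideal_def quotient_scale polynomial_submodule_def)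
next
  fix \<sigma> u assume "\<sigma> \<in> Aut E"
  then show "gact (polynomial_submodule (slim_space E)) \<sigma> u +o power_ideal E =
      gact (quotient_module (power_ideal E)) \<sigma> (u +o power_ideal E)"
    by (simp add: quotient_act[OF permute_vars_power_ideal[OF E]] polynomial_submodule_def)
qed

lemma slim_space_submodule_closed:
  assumes E: "loopless E" "connected_graph UNIV E"
  shows "u \<in> gelems (polynomial_submodule (slim_space E)) \<Longrightarrow> v \<in> gelems (polynomial_submodule (slim_space E))
      \<Longrightarrow> gadd (polynomial_submodule (slim_space E)) u v \<in> gelems (polynomial_submodule (slim_space E))"
    "u \<in> gelems (polynomial_submodule (slim_space E)) \<Longrightarrow>
      gscale (polynomial_submodule (slim_space E)) c u \<in> gelems (polynomial_submodule (slim_space E))"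
    "\<sigma> \<in> Aut E \<Longrightarrow> u \<in> gelems (polynomial_submodule (slim_space E)) \<Longrightarrow>
      gact (polynomial_submodule (slim_space E)) \<sigma> u \<in> gelems (polynomial_submodule (slim_space E))"
  by (simp_all add: polynomial_submodule_def slim_space_closed permute_vars_slim_space[OF E])

lemma hcomponent_power_ideal:
  fixes E :: "'n::{finite, linorder} set multiset"
  assumes E: "loopless E" "connected_graph UNIV E" and u: "u \<in> power_ideal E"
  shows "hcomponent d u \<in> power_ideal E"
  using u by (simp add: power_ideal_eq_orthogonal[OF E] pairing_hcomponent hcomponent_slim_space)

text \<open>
  The representative in the slim space of a homogeneous coset can be taken homogeneous, because the
  power ideal is.
\<close>

lemma quotient_graded_iso_slim_space:
  fixes E :: "'n::{finite, linorder} set multiset"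
  assumes E: "loopless E" "connected_graph UNIV E"
  shows "graded_gmodule_isomorphic (Aut E) (quotient_module (power_ideal E))
    (polynomial_submodule (slim_space E))"
  unfolding graded_gmodule_isomorphic_def
proof (intro exI conjI allI)
  let ?I = "power_ideal E" and ?P = "slim_space E"
  let ?\<psi> = "\<lambda>p. p +o ?I"
  let ?\<phi> = "inv_into (gelems (polynomial_submodule ?P)) ?\<psi>"
  note iso = slim_space_iso_quotient[OF E]
  show "is_gmodule_iso (Aut E) (quotient_module ?I) (polynomial_submodule ?P) ?\<phi>"
    using slim_space_submodule_closed[OF E] by (intro is_gmodule_iso_inverse iso)
  fix d
  have "\<exists>p\<in>?P. homogeneous d p \<and> f +o ?I = p +o ?I" if f: "homogeneous d f" for f
  proof -
    obtain p where p: "p \<in> ?P" "f - p \<in> ?I" using slim_space_power_ideal_decomposition[OF E] by blast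
    have "hcomponent d (f - p) = f - hcomponent d p" using f by (simp add: hcomponent_homogeneous)
    then have "f - hcomponent d p \<in> ?I" using hcomponent_power_ideal[OF E p(2), of d] by simp
    then have "f +o ?I = hcomponent d p +o ?I" by (simp add: power_ideal_def coset_eq_iff)
    then show ?thesis using hcomponent_slim_space[OF p(1)] homogeneous_hcomponent by blast
  qed
  then have "gpart (quotient_module ?I) d = ?\<psi> ` gpart (polynomial_submodule ?P) d"
    by (fastforce simp: quotient_module_def polynomial_submodule_def)
  moreover have "inj_on ?\<psi> (gelems (polynomial_submodule ?P))"
    using iso by (simp add: is_gmodule_iso_def bij_betw_def)
  moreover have "gpart (polynomial_submodule ?P) d \<subseteq> gelems (polynomial_submodule ?P)"
    by (auto simp: polynomial_submodule_def)
  ultimately show "?\<phi> ` gpart (quotient_module ?I) d = gpart (polynomial_submodule ?P) d"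
    by (simp add: inv_into_image_cancel)
qed

definition evaluate_on :: "('n::finite \<Rightarrow> nat) set \<Rightarrow> 'n rpoly \<Rightarrow> ('n \<Rightarrow> nat) \<Rightarrow>\<^sub>0 rat" where
  "evaluate_on B f = (\<Sum>D\<in>B. Poly_Mapping.single D (at_divisor D f))"

lemma lookup_evaluate_on:
  "finite B \<Longrightarrow> Poly_Mapping.lookup (evaluate_on B f) D = (if D \<in> B then at_divisor D f else 0)"
  by (simp add: evaluate_on_def lookup_sum lookup_single when_def)

text \<open>
  The coefficient at \<open>D\<close> after the action is the one at \<open>D \<circ> \<sigma>\<close> before it, in agreement with the value of
  \<open>permute_vars \<sigma> f\<close> at \<open>D\<close>, which is the value of \<open>f\<close> at \<open>D \<circ> \<sigma>\<close>.
\<close>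

lemma lookup_permutation_act:
  assumes "\<sigma> permutes UNIV"
  shows "Poly_Mapping.lookup (gact (permutation_module B) \<sigma> a) D = Poly_Mapping.lookup a (D \<circ> \<sigma>)"
proof -
  have "D' \<circ> inv \<sigma> = D \<longleftrightarrow> D' = D \<circ> \<sigma>" for D'
    using permutes_inv_o[OF assms] by (metis comp_assoc comp_id)
  then show ?thesis
    by (simp add: permutation_module_def lookup_sum lookup_single when_def in_keys_iff)
qed

lemma slim_space_iso_permutation_module:
  fixes E :: "'n::{finite, linorder} set multiset"
  assumes E: "loopless E" "connected_graph UNIV E"
  shows "is_gmodule_iso (Aut E) (polynomial_submodule (slim_space E)) (permutation_module (break_divisors E))
    (evaluate_on (break_divisors E))"
  unfolding is_gmodule_iso_def
proof (intro conjI ballI allI)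
  let ?P = "slim_space E" and ?B = "break_divisors E"
  note look = lookup_evaluate_on[OF finite_break_divisors[of E]]
  have "inj_on (evaluate_on ?B) ?P"
  proof (rule inj_onI)
    fix p q assume pq: "p \<in> ?P" "q \<in> ?P" "evaluate_on ?B p = evaluate_on ?B q"
    have "at_divisor D p = at_divisor D q" if "D \<in> ?B" for D
      using that arg_cong[OF pq(3), of "\<lambda>a. Poly_Mapping.lookup a D"] by (simp add: look)
    then have "p - q \<in> vanishing_ideal E" by (simp add: vanishing_ideal_def)
    then show "p = q" using slim_space_Int_vanishing_ideal[OF E] slim_space_closed(2)[OF pq(1,2)] by force
  qed
  moreover have "evaluate_on ?B ` ?P = {a. Poly_Mapping.keys a \<subseteq> ?B}"
  proof (intro equalityI subsetI)
    fix a assume "a \<in> evaluate_on ?B ` ?P"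
    then show "a \<in> {a. Poly_Mapping.keys a \<subseteq> ?B}" by (auto simp: in_keys_iff look split: if_splits)
  next
    fix a :: "('n \<Rightarrow> nat) \<Rightarrow>\<^sub>0 rat"
    assume "a \<in> {a. Poly_Mapping.keys a \<subseteq> ?B}"
    then have a: "Poly_Mapping.lookup a D = 0" if "D \<notin> ?B" for D using that by (auto simp: in_keys_iff)
    obtain f where f: "\<And>D. D \<in> ?B \<Longrightarrow> at_divisor D f = Poly_Mapping.lookup a D"
      using interpolation[OF finite_break_divisors] by blast
    obtain p where p: "p \<in> ?P" "f - p \<in> vanishing_ideal E"
      using slim_space_vanishing_ideal_decomposition[OF E] by blast
    have "at_divisor D p = Poly_Mapping.lookup a D" if "D \<in> ?B" for D
      using p(2) f that by (simp add: vanishing_ideal_def)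
    then have "evaluate_on ?B p = a" by (intro poly_mapping_eqI) (simp add: look a)
    then show "a \<in> evaluate_on ?B ` ?P" using p(1) by blast
  qed
  ultimately show "bij_betw (evaluate_on ?B) (gelems (polynomial_submodule ?P)) (gelems (permutation_module ?B))"
    by (simp add: bij_betw_def polynomial_submodule_def permutation_module_def)
  fix u v c
  show "evaluate_on ?B (gadd (polynomial_submodule ?P) u v) =
      gadd (permutation_module ?B) (evaluate_on ?B u) (evaluate_on ?B v)"
    by (rule poly_mapping_eqI) (simp add: look lookup_add polynomial_submodule_def permutation_module_def)
  show "evaluate_on ?B (gscale (polynomial_submodule ?P) c u) = gscale (permutation_module ?B) c (evaluate_on ?B u)"
    by (rule poly_mapping_eqI)
      (simp add: look polynomial_submodule_def permutation_module_def Poly_Mapping.map.rep_eq when_def)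
next
  let ?P = "slim_space E" and ?B = "break_divisors E"
  note look = lookup_evaluate_on[OF finite_break_divisors[of E]]
  fix \<sigma> u assume \<sigma>: "\<sigma> \<in> Aut E"
  have mem: "D \<circ> \<sigma> \<in> ?B \<longleftrightarrow> D \<in> ?B" for D
  proof
    assume "D \<circ> \<sigma> \<in> ?B"
    from break_divisors_comp[OF E(1) inv_Aut[OF \<sigma>] this] show "D \<in> ?B"
      using Aut_comp_inv(1)[OF \<sigma>] by (simp add: comp_assoc)
  qed (rule break_divisors_comp[OF E(1) \<sigma>])
  show "evaluate_on ?B (gact (polynomial_submodule ?P) \<sigma> u) = gact (permutation_module ?B) \<sigma> (evaluate_on ?B u)"
  proof (rule poly_mapping_eqI)
    fix D
    have "(\<lambda>i. of_nat (D i)) \<circ> \<sigma> = (\<lambda>i. of_nat ((D \<circ> \<sigma>) i) :: rat)" by auto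
    then show "Poly_Mapping.lookup (evaluate_on ?B (gact (polynomial_submodule ?P) \<sigma> u)) D =
        Poly_Mapping.lookup (gact (permutation_module ?B) \<sigma> (evaluate_on ?B u)) D"
      using mem[of D] unfolding lookup_permutation_act[OF AutD(3)[OF \<sigma>]] look
      by (simp only: polynomial_submodule_def gmodule.select_convs poly_eval_permute_vars)
  qed
qed

theorem theorem1p1:
  fixes E :: "'n::{finite, linorder} set multiset"
  assumes "loopless E" and "connected_graph UNIV E"
  shows "gmodule_isomorphic (Aut E) (permutation_module (break_divisors E)) (quotient_module (T_ideal E))
    \<and> quotient_module (T_ideal E) = quotient_module (power_ideal E)
    \<and> graded_gmodule_isomorphic (Aut E) (quotient_module (power_ideal E))
        (polynomial_submodule (slim_space E))"
proof (intro conjI)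
  have "is_gmodule_iso (Aut E) (permutation_module (break_divisors E)) (polynomial_submodule (slim_space E))
      (inv_into (gelems (polynomial_submodule (slim_space E))) (evaluate_on (break_divisors E)))"
    using slim_space_submodule_closed[OF assms]
    by (intro is_gmodule_iso_inverse slim_space_iso_permutation_module[OF assms])
  from is_gmodule_iso_trans[OF this slim_space_iso_quotient[OF assms]]
  show "gmodule_isomorphic (Aut E) (permutation_module (break_divisors E)) (quotient_module (T_ideal E))"
    unfolding gmodule_isomorphic_def T_ideal_eq_power_ideal[OF assms] by blast
  show "quotient_module (T_ideal E) = quotient_module (power_ideal E)"
    by (simp only: T_ideal_eq_power_ideal[OF assms])
  show "graded_gmodule_isomorphic (Aut E) (quotient_module (power_ideal E))
      (polynomial_submodule (slim_space E))"
    by (rule quotient_graded_iso_slim_space[OF assms])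
qed

end
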